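(* Let $F$ be a perfect tract, $\Gamma$ an ordered abelian group, $E$ a finite totally ordered set and $1\le r\le |E|$. Let $P\colon \binom{E}{r}\to F[\Gamma]$ be a function (representing $M$), and for $\mathbf u\in\Gamma^E$ let $P^{\mathbf u}\colon\binom{E}{r}\to F$ be its initial function (representing $M^{\mathbf u}$). Then $P$ is the Plücker vector of an $F[\Gamma]$-matroid $M$ if and only if, for all $\mathbf u\in\Gamma^E$, $P^{\mathbf u}$ is the Plücker vector of an $F$-matroid $M^{\mathbf u}$.
   Context: Tracts. A tract $F=(F^\times,N_F)$ is a multiplicative abelian group $F^\times$ (identity $1$) together with a subset $N_F$ (the null set) of the group semiring $\mathbb N[F^\times]$ of finite formal sums such that: $0\in N_F$; $1\notin N_F$; there is a unique element $-1\in F^\times$ with $1+(-1)\in N_F$; and if $\sum a_i\in N_F$ then $\sum c a_i\in N_F$ for all $c\in F^\times$. We also write $F=F^\times\cup\{0\}$ with $0\cdot g=0$; zero terms of formal sums are dropped. A homomorphism of tracts $F_1\to F_2$ is a group homomorphism $F_1^\times\to F_2^\times$ whose induced map on formal sums sends $N_{F_1}$ into $N_{F_2}$ (extended by $0\mapsto0$). Every tract carries a fixed involution $a\mapsto\overline a$ (a tract homomorphism $F\to F$ squaring to the identity; it may be the identity); on $F[\Gamma]$ (below) the involution is $\overline{(a,\gamma)}=(\overline a,\gamma)$. Tropical extension. $\Gamma$ is a (totally) ordered abelian group, written additively; $\infty$ is larger than every element of $\Gamma$ and absorbing. $F[\Gamma]$ is the tract with group $F^\times\times\Gamma$, zero element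 $\infty$, and null set consisting of the zero sum and all finite sums $\sum_{i\in I}(a_i,\gamma_i)$ with $\sum_{i\in I_{\min}}a_i\in N_F$, where $I_{\min}=\{i\in I:\gamma_i\le\gamma_j\ \forall j\in I\}$. Put $\theta(a,\gamma)=a$, $\theta(\infty)=0$, and $|(a,\gamma)|=\gamma$, $|\infty|=\infty$. Matroids. For a tract $F$, a (strong) Plücker vector of rank $r$ on $E$ is a function $P\colon\binom Er\to F$, not identically zero, such that for all $I\in\binom{E}{r-1}$, $J\in\binom{E}{r+1}$, $$\sum_{j\in J\setminus I}\operatorname{sign}(j;I,J)\,P(I+j)\,P(J-j)\in N_F,$$ where $\operatorname{sign}(j;I,J)=(-1)^\ell$, $\ell=\#\{j'\in J:j<j'\}+\#\{i\in I:j<i\}$. An $F$-matroid $M$ is an equivalence class of Plücker vectors under scaling by $F^\times$. (Over a perfect tract weak and strong matroids coincide, so "$F$-matroid" is unambiguous.) Circuits, duals, perfect tracts. For $\tau=\{i_0<\dots<i_r\}\subseteq E$ let $C_\tau\in F^E$ have entries $(C_\tau)_{i_s}=(-1)^sP(\tau-i_s)$ and $0$ elsewhere; the circuits $\mathcal C(M)$ are the nonzero scalar multiples (by $F^\times$) of the nonzero $C_\tau$. $X,Y\in F^E$ are orthogonal, $X\perp Y$, if $\sum_{i\in E} X_i\overline{Y_i}\in N_F$; $\mathcal X^\perp$ is the set of tuples orthogonal to all of $\mathcal X$. The dual $M^*$ has Plücker vector $P^*(I)=\operatorname{sign}(I,I^c)\overline{P(I^c)}$, $I^c=E\setminus I$,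 where $\operatorname{sign}(I,I^c)$ is the sign of the permutation listing $I$ then $I^c$, each increasingly. Covectors: $\mathcal V^*(M)=\mathcal C(M)^\perp$; vectors: $\mathcal V(M)=\mathcal C(M^* )^\perp$. $F$ is perfect if $\mathcal V(M)^\perp=\mathcal V^*(M)$ for every $F$-matroid $M$. Initial function. For $P\colon\binom Er\to F[\Gamma]$ and $\mathbf u\in\Gamma^E$, $P^{\mathbf u}(I)=\theta(P(I))$ if $|P(I)|-\sum_{i\in I}u_i\le|P(J)|-\sum_{j\in J}u_j$ for all $J\in\binom Er$, and $P^{\mathbf u}(I)=0$ otherwise. *)

theory Defs
  imports
    "HOL-Library.Multiset"
    "HOL-Library.Extended"
    "HOL-Library.Ramsey"
    "HOL-Combinatorics.Permutations"
    "HOL-Algebra.Group"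
begin

section \<open>Tracts\<close>

text \<open>
  The record carries the group of units, with its elements in the carrier. Elements of the group
  semiring over the natural numbers are finite multisets of units.
\<close>

record 'a tract = "'a monoid" +
  null :: "'a multiset set"
  invol :: "'a \<Rightarrow> 'a"

definition tract_hom :: "'a tract \<Rightarrow> 'b tract \<Rightarrow> ('a \<Rightarrow> 'b) set" where
  "tract_hom F G = {h \<in> hom F G. \<forall>S \<in> null F. image_mset h S \<in> null G}"

locale tract = comm_group F for F :: "'a tract" (structure) +
  assumes null_carrier: "S \<in> null F \<Longrightarrow> set_mset S \<subseteq> carrier F"
    and null_zero: "{#} \<in> null F"
    and one_not_null: "{#\<one>#} \<notin> null F"
    and ex1_neg_one: "\<exists>!e. e \<in> carrier F \<and> {#\<one>, e#} \<in> null F"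
    and null_scale: "S \<in> null F \<Longrightarrow> c \<in> carrier F \<Longrightarrow> image_mset (\<lambda>a. c \<otimes> a) S \<in> null F"
    and invol_hom: "invol F \<in> tract_hom F F"
    and invol_invol: "a \<in> carrier F \<Longrightarrow> invol F (invol F a) = a"

definition neg_one :: "'a tract \<Rightarrow> 'a" where
  "neg_one F = (THE e. e \<in> carrier F \<and> {#\<one>\<^bsub>F\<^esub>, e#} \<in> null F)"

text \<open>The tract with its zero adjoined is modelled by options, the zero being \<^const>\<open>None\<close>.\<close>

definition carrier0 :: "'a tract \<Rightarrow> 'a option set" where
  "carrier0 F = insert None (Some ` carrier F)"

definition mult0 :: "'a tract \<Rightarrow> 'a option \<Rightarrow> 'a option \<Rightarrow> 'a option" where
  "mult0 F x y = (case (x, y) of (Some a, Some b) \<Rightarrow> Some (a \<otimes>\<^bsub>F\<^esub> b) | _ \<Rightarrow> None)"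

definition invol0 :: "'a tract \<Rightarrow> 'a option \<Rightarrow> 'a option" where
  "invol0 F = map_option (invol F)"

definition sign0 :: "'a tract \<Rightarrow> int \<Rightarrow> 'a option" where
  \<comment> \<open>only ever used for the integers 1 and -1\<close>
  "sign0 F s = Some (if s = 1 then \<one>\<^bsub>F\<^esub> else neg_one F)"

text \<open>The formal sum of the \<open>f x\<close> for \<open>x\<close> in the finite set \<open>A\<close>, zero terms being dropped.\<close>

definition formal_sum :: "('b \<Rightarrow> 'a option) \<Rightarrow> 'b set \<Rightarrow> 'a multiset" where
  "formal_sum f A = image_mset (\<lambda>x. the (f x)) (mset_set {x \<in> A. f x \<noteq> None})"

definition scale :: "'a tract \<Rightarrow> 'b set \<Rightarrow> 'a \<Rightarrow> ('b \<Rightarrow> 'a option) \<Rightarrow> 'b \<Rightarrow> 'a option" where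
  "scale F A c f = (\<lambda>x\<in>A. mult0 F (Some c) (f x))"


section \<open>Tropical extensions\<close>

definition tropical_extension :: "'a tract \<Rightarrow> ('a \<times> 'g::linordered_ab_group_add) tract" where
  "tropical_extension F =
    \<lparr>carrier = carrier F \<times> UNIV,
     monoid.mult = (\<lambda>(a, \<gamma>) (b, \<delta>). (a \<otimes>\<^bsub>F\<^esub> b, \<gamma> + \<delta>)),
     one = (\<one>\<^bsub>F\<^esub>, 0),
     null = {S. set_mset S \<subseteq> carrier F \<times> UNIV \<and>
       (S = {#} \<or> image_mset fst (filter_mset (\<lambda>x. \<forall>y \<in># S. snd x \<le> snd y) S) \<in> null F)},
     invol = (\<lambda>(a, \<gamma>). (invol F a, \<gamma>))\<rparr>"

definition theta :: "('a \<times> 'g) option \<Rightarrow> 'a option" where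
  "theta = map_option fst"

text \<open>Only the values \<^term>\<open>Fin \<gamma>\<close> and \<^term>\<open>Pinf\<close> occur.\<close>

definition val :: "('a \<times> 'g) option \<Rightarrow> 'g extended" where
  "val x = (case x of None \<Rightarrow> Pinf | Some (a, \<gamma>) \<Rightarrow> Fin \<gamma>)"


section \<open>Matroids over tracts\<close>

text \<open>
  Functions on the \<open>r\<close>-subsets of \<open>E\<close>, and tuples indexed by \<open>E\<close>, are extensional functions.
\<close>

definition plucker_sign :: "'e::linorder \<Rightarrow> 'e set \<Rightarrow> 'e set \<Rightarrow> int" where
  "plucker_sign j I J = (-1) ^ (card {j' \<in> J. j < j'} + card {i \<in> I. j < i})"

definition plucker_vector ::
    "'a tract \<Rightarrow> 'e::linorder set \<Rightarrow> nat \<Rightarrow> ('e set \<Rightarrow> 'a option) \<Rightarrow> bool" where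
  "plucker_vector F E r P \<longleftrightarrow>
    P \<in> nsets E r \<rightarrow>\<^sub>E carrier0 F \<and>
    (\<exists>I \<in> nsets E r. P I \<noteq> None) \<and>
    (\<forall>I J. I \<subseteq> E \<longrightarrow> card I + 1 = r \<longrightarrow> J \<in> nsets E (r + 1) \<longrightarrow>
      formal_sum
        (\<lambda>j. mult0 F (sign0 F (plucker_sign j I J)) (mult0 F (P (insert j I)) (P (J - {j}))))
        (J - I) \<in> null F)"

definition plucker_equiv ::
    "'a tract \<Rightarrow> 'e::linorder set \<Rightarrow> nat \<Rightarrow> (('e set \<Rightarrow> 'a option) \<times> ('e set \<Rightarrow> 'a option)) set" where
  "plucker_equiv F E r =
    {(P, Q). plucker_vector F E r P \<and> plucker_vector F E r Q \<and>
      (\<exists>c \<in> carrier F. Q = scale F (nsets E r) c P)}"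

definition matroids :: "'a tract \<Rightarrow> 'e::linorder set \<Rightarrow> nat \<Rightarrow> ('e set \<Rightarrow> 'a option) set set" where
  "matroids F E r = {P. plucker_vector F E r P} // plucker_equiv F E r"


section \<open>Circuits, duals, vectors and covectors\<close>

text \<open>The exponent is the position of \<open>x\<close> in \<open>\<tau>\<close>, counted from 0.\<close>

definition circuit_vector ::
    "'a tract \<Rightarrow> 'e::linorder set \<Rightarrow> ('e set \<Rightarrow> 'a option) \<Rightarrow> 'e set \<Rightarrow> 'e \<Rightarrow> 'a option" where
  "circuit_vector F E P \<tau> = (\<lambda>x\<in>E.
    if x \<in> \<tau> then mult0 F (sign0 F ((-1) ^ card {y \<in> \<tau>. y < x})) (P (\<tau> - {x})) else None)"

definition circuits ::
    "'a tract \<Rightarrow> 'e::linorder set \<Rightarrow> nat \<Rightarrow> ('e set \<Rightarrow> 'a option) set \<Rightarrow> ('e \<Rightarrow> 'a option) set" where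
  "circuits F E r M =
    {scale F E c (circuit_vector F E P \<tau>) | c P \<tau>.
      c \<in> carrier F \<and> P \<in> M \<and> \<tau> \<in> nsets E (r + 1) \<and>
      (\<exists>x \<in> E. circuit_vector F E P \<tau> x \<noteq> None)}"

definition orthogonal ::
    "'a tract \<Rightarrow> 'e set \<Rightarrow> ('e \<Rightarrow> 'a option) \<Rightarrow> ('e \<Rightarrow> 'a option) \<Rightarrow> bool" where
  "orthogonal F E X Y \<longleftrightarrow> formal_sum (\<lambda>i. mult0 F (X i) (invol0 F (Y i))) E \<in> null F"

definition perp :: "'a tract \<Rightarrow> 'e set \<Rightarrow> ('e \<Rightarrow> 'a option) set \<Rightarrow> ('e \<Rightarrow> 'a option) set" where
  "perp F E \<X> = {Y \<in> E \<rightarrow>\<^sub>E carrier0 F. \<forall>X \<in> \<X>. orthogonal F E Y X}"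

text \<open>
  The sign of the permutation of \<open>E\<close> taking the increasing list of \<open>E\<close> to the increasing list of
  \<open>I\<close> followed by that of its complement.
\<close>

definition complement_sign :: "'e::linorder set \<Rightarrow> 'e set \<Rightarrow> int" where
  "complement_sign E I = sign (permutation_of_list
    (zip (sorted_list_of_set E) (sorted_list_of_set I @ sorted_list_of_set (E - I))))"

definition dual_plucker ::
    "'a tract \<Rightarrow> 'e::linorder set \<Rightarrow> nat \<Rightarrow> ('e set \<Rightarrow> 'a option) \<Rightarrow> 'e set \<Rightarrow> 'a option" where
  "dual_plucker F E r P = (\<lambda>I \<in> nsets E (card E - r).
    mult0 F (sign0 F (complement_sign E I)) (invol0 F (P (E - I))))"

text \<open>The dual of a matroid of rank \<open>r\<close> on \<open>E\<close>; its rank is \<^term>\<open>card E - r\<close>.\<close>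

definition dual ::
    "'a tract \<Rightarrow> 'e::linorder set \<Rightarrow> nat \<Rightarrow> ('e set \<Rightarrow> 'a option) set \<Rightarrow> ('e set \<Rightarrow> 'a option) set" where
  "dual F E r M = dual_plucker F E r ` M"

definition covectors ::
    "'a tract \<Rightarrow> 'e::linorder set \<Rightarrow> nat \<Rightarrow> ('e set \<Rightarrow> 'a option) set \<Rightarrow> ('e \<Rightarrow> 'a option) set" where
  "covectors F E r M = perp F E (circuits F E r M)"

definition vectors ::
    "'a tract \<Rightarrow> 'e::linorder set \<Rightarrow> nat \<Rightarrow> ('e set \<Rightarrow> 'a option) set \<Rightarrow> ('e \<Rightarrow> 'a option) set" where
  "vectors F E r M = perp F E (circuits F E (card E - r) (dual F E r M))"

text \<open>
  Every finite totally ordered set is order-isomorphic to a finite set of natural numbers, so it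
  suffices to let the ground sets range over the latter.
\<close>

locale perfect_tract = tract +
  assumes perfect:
    "finite (E :: nat set) \<Longrightarrow> M \<in> matroids F E r \<Longrightarrow>
      perp F E (vectors F E r M) = covectors F E r M"


section \<open>Initial functions\<close>

definition initial ::
    "'e set \<Rightarrow> nat \<Rightarrow> ('e set \<Rightarrow> ('a \<times> 'g::linordered_ab_group_add) option) \<Rightarrow> ('e \<Rightarrow> 'g)
      \<Rightarrow> 'e set \<Rightarrow> 'a option" where
  "initial E r P u = (\<lambda>I \<in> nsets E r.
    if \<forall>J \<in> nsets E r. val (P I) - Fin (sum u I) \<le> val (P J) - Fin (sum u J)
    then theta (P I) else None)"

end

theory Submission
  imports Defs
begin

text \<open>
  The initial function \<open>P\<^sup>u\<close> picks out the terms of lowest level, so the Plucker relations of \<open>P\<^sup>u\<close> are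
  leading parts of those of \<open>P\<close>; this gives one direction without using perfection.

  Conversely, let \<open>X\<close> be the leading part, with respect to \<open>u\<close>, of the circuit of \<open>P\<close> supported in
  \<open>J\<close>. Then \<open>X\<close> is orthogonal to all cocircuits of \<open>P\<^sup>u\<close>. When all bases lie in \<open>J\<close>, this is a Plucker
  relation of \<open>P\<^sup>u\<close>. Otherwise delete an element \<open>x\<close> outside \<open>J\<close> and induct: changing only the coordinate
  \<open>u x\<close> one finds \<open>u'\<close> such that the initial function of the deletion at \<open>u\<close> is the deletion of \<open>P\<^bsup>u'\<^esup>\<close>,
  while \<open>P\<^sup>u\<close> is \<open>P\<^bsup>u'\<^esup>\<close> or its deletion or contraction by \<open>x\<close>. Since a cocircuit of \<open>P\<^bsup>u'\<^esup>\<close> avoiding \<open>x\<close> is a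
  covector of the deletion, perfection lifts orthogonality from the deletion to \<open>P\<^bsup>u'\<^esup>\<close>. Moving one
  coordinate at a time keeps every critical weight inside \<open>\<Gamma>\<close>, which need not be divisible.

  Finally, given \<open>I\<close> and \<open>J\<close>, a weight \<open>u\<close> that agrees with the cocircuit of \<open>I\<close> on its support and is
  large elsewhere turns the orthogonality above into the Plucker relation of \<open>P\<close> for \<open>I\<close> and \<open>J\<close>.
\<close>

section \<open>The sign of a complement\<close>

text \<open>Exchanging the two values \<open>a\<close> and \<open>b\<close> composes the permutation
  with \<open>transpose a b\<close> on the left, which is odd.\<close>

lemma sign_permutation_of_list_swap:
  assumes "distinct xs" "distinct (us @ a # b # vs)" "set xs = set (us @ a # b # vs)"
    and "length xs = length (us @ a # b # vs)"
  shows "sign (permutation_of_list (zip xs (us @ a # b # vs))) =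
    - sign (permutation_of_list (zip xs (us @ b # a # vs)))"
proof -
  let ?p = "permutation_of_list (zip xs (us @ a # b # vs))"
  let ?q = "permutation_of_list (zip xs (us @ b # a # vs))"
  have q: "?q permutes set xs" 
    using assms by (intro permutation_of_list_permutes) (auto simp: list_permutes_def)
  have "?p x = transpose a b (?q x)" for x
  proof (cases "x \<in> set xs")
    case True
    then obtain i where i: "i < length xs" "x = xs ! i"
      by (metis in_set_conv_nth)
    let ?y = "us @ a # b # vs" and ?z = "us @ b # a # vs"
    have p: "?p x = ?y ! i" "?q x = ?z ! i"
      using assms i by (auto intro!: permutation_of_list_unique' simp: set_zip)
    have d: "?y ! j = ?y ! k \<longleftrightarrow> j = k" if "j < length xs" "k < length xs" for j k
      using assms(2,4) that nth_eq_iff_index_eq by metis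
    consider "i = length us" | "i = Suc (length us)" | "i \<noteq> length us" "i \<noteq> Suc (length us)"
      by blast
    then show ?thesis
    proof cases
      case 3
      have "?y ! i \<noteq> ?y ! length us" "?y ! i \<noteq> ?y ! Suc (length us)"
        using d[OF i(1), of "length us"] d[OF i(1), of "Suc (length us)"] 3 assms(4) by auto
      moreover have "?y ! i = ?z ! i"
        using 3 by (auto simp: nth_append nth_Cons split: nat.split)
      ultimately show ?thesis unfolding p 
        by (simp add: nth_append transpose_def)
    qed (simp_all add: p nth_append)
  next
    case False
    then have "x \<notin> set (map fst (zip xs ys))" for ys :: "'a list"
      by (auto dest: set_zip_leftD)
    then have "?p x = x" "?q x = x" by (simp_all only: permutation_of_list_id not_False_eq_True)
    moreover have "x \<noteq> a" "x \<noteq> b" using False assms(3) by auto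
    ultimately show ?thesis by (simp add: transpose_def)
  qed
  then have "?p = transpose a b \<circ> ?q" by auto
  moreover have "permutation ?q" using q permutation_permutes by blast
  moreover have "a \<noteq> b" using assms(2) by auto
  ultimately show ?thesis
    by (simp add: sign_compose permutation_swap_id sign_swap_id)
qed

text \<open>One adjacent swap carries \<open>m\<close> past each element of \<open>vs\<close>. This
  is how a greatest element is brought to the end of the list.\<close>

lemma sign_permutation_of_list_move:
  assumes "distinct xs" "distinct (us @ m # vs)" "set xs = set (us @ m # vs)"
    and "length xs = length (us @ m # vs)"
  shows "sign (permutation_of_list (zip xs (us @ m # vs))) =
    (-1) ^ length vs * sign (permutation_of_list (zip xs (us @ vs @ [m])))"
  using assms
proof (induction vs arbitrary: us)
  case (Cons v vs)
  have "sign (permutation_of_list (zip xs (us @ m # v # vs))) =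
    - sign (permutation_of_list (zip xs ((us @ [v]) @ m # vs)))"
    using sign_permutation_of_list_swap[of xs us m v vs] Cons.prems by simp
  also have "sign (permutation_of_list (zip xs ((us @ [v]) @ m # vs))) =
    (-1) ^ length vs * sign (permutation_of_list (zip xs ((us @ [v]) @ vs @ [m])))"
    by (rule Cons.IH) (use Cons.prems in auto)
  finally show ?case by simp
qed simp

lemma sorted_list_of_set_insert_greatest:
  assumes "finite A" "\<forall>a\<in>A. a < (m::'a::linorder)"
  shows "sorted_list_of_set (insert m A) = sorted_list_of_set A @ [m]"
proof -
  have "m \<notin> A" using assms by auto
  then show ?thesis
    using assms by (subst sorted_list_of_set_unique[symmetric]) (auto simp: sorted_wrt_append)
qed

text \<open>\<open>permutation_of_list\<close> is the identity off its keys, so pairing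
  \<open>m\<close> with itself amounts to omitting it.\<close>

lemma permutation_of_list_zip_snoc:
  assumes "distinct xs" "m \<notin> set xs" "length xs = length ys"
  shows "permutation_of_list (zip (xs @ [m]) (ys @ [m])) = permutation_of_list (zip xs ys)"
  using assms
  by (auto simp: permutation_of_list_def fun_eq_iff map_add_def split: option.splits
      dest!: map_of_SomeD dest: set_zip_leftD)

text \<open>The exponent counts inversions: both lists are increasing, so an inversion pairs an
  element of \<open>A\<close> with a smaller one of its complement. The induction adds a greatest
  element \<open>m\<close>. Outside \<open>A\<close> it is already last and creates no inversion;
  inside \<open>A\<close> it has to pass the whole complement.\<close>

lemma complement_sign_eq:
  fixes E :: "'e::linorder set"
  assumes "finite E" "A \<subseteq> E"
  shows "complement_sign E A = (-1) ^ card {(a, b). a \<in> A \<and> b \<in> E - A \<and> b < a}"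
  using assms
proof (induction E arbitrary: A rule: finite_linorder_max_induct)
  case empty
  then show ?case by (simp add: complement_sign_def permutation_of_list_def[abs_def])
next
  case (insert m E)
  have m: "m \<notin> E" using insert by auto
  let ?l = sorted_list_of_set
  have fin: "finite (B :: 'e set)" if "B \<subseteq> insert m E" for B
    using that insert(1) finite_subset by blast
  show ?case
  proof (cases "m \<in> A")
    case False
    then have A: "A \<subseteq> E" "insert m E - A = insert m (E - A)" using insert.prems by auto
    have "{(a, b). a \<in> A \<and> b \<in> insert m E - A \<and> b < a} =
        {(a, b). a \<in> A \<and> b \<in> E - A \<and> b < a}"
      using A insert(2) by fastforce
    moreover have "complement_sign (insert m E) A = complement_sign E A"
    proof -
      have "length (?l E) = length (?l A @ ?l (E - A))"
        using A insert(1) by (simp add: card_Diff_subset card_mono finite_subset)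
      moreover have "?l (insert m E - A) = ?l (E - A) @ [m]"
        unfolding A(2) using insert by (intro sorted_list_of_set_insert_greatest) auto
      ultimately show ?thesis
        using permutation_of_list_zip_snoc[of "?l E" m "?l A @ ?l (E - A)"] m
          sorted_list_of_set_insert_greatest[OF insert(1,2)] insert(1)
        by (simp add: complement_sign_def)
    qed
    ultimately show ?thesis using insert.IH[OF A(1)] by simp
  next
    case True
    define B where "B = A - {m}"
    have B: "A = insert m B" "m \<notin> B" "B \<subseteq> E" "insert m E - A = E - B"
      using True insert.prems m unfolding B_def by auto
    have fB: "finite B" using B(3) insert(1) finite_subset by blast
    have len: "length (?l E) = length (?l B @ ?l (E - B))"
      using B insert(1) fB by (simp add: card_Diff_subset card_mono)
    have A: "?l A = ?l B @ [m]"
      unfolding B(1) using insert B by (intro sorted_list_of_set_insert_greatest fB) auto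
    have "complement_sign (insert m E) A =
        sign (permutation_of_list (zip (?l E @ [m]) (?l B @ m # ?l (E - B))))"
      unfolding complement_sign_def B(4) A
      using sorted_list_of_set_insert_greatest[OF insert(1,2)] by simp
    also have "\<dots> = (-1) ^ card (E - B) *
        sign (permutation_of_list (zip (?l E @ [m]) ((?l B @ ?l (E - B)) @ [m])))"
      using m B fB len insert(1) by (subst sign_permutation_of_list_move) auto
    also have "permutation_of_list (zip (?l E @ [m]) ((?l B @ ?l (E - B)) @ [m])) =
        permutation_of_list (zip (?l E) (?l B @ ?l (E - B)))"
      using len m insert(1) by (intro permutation_of_list_zip_snoc) auto
    also have "sign \<dots> = complement_sign E B" by (simp add: complement_sign_def)
    also have "\<dots> = (-1) ^ card {(a, b). a \<in> B \<and> b \<in> E - B \<and> b < a}"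
      by (rule insert.IH[OF B(3)])
    also have "(-1) ^ card (E - B) * \<dots> =
        (-1) ^ card ({m} \<times> (E - B) \<union> {(a, b). a \<in> B \<and> b \<in> E - B \<and> b < a} :: ('e \<times> 'e) set)"
    proof -
      have "finite {(a, b). a \<in> B \<and> b \<in> E - B \<and> b < a}"
        by (rule finite_subset[of _ "B \<times> E"]) (use fB insert(1) in auto)
      then show ?thesis
        using insert(1) B(2) by (subst card_Un_disjoint) (auto simp: power_add card_cartesian_product)
    qed
    also have "{m} \<times> (E - B) \<union> {(a, b). a \<in> B \<and> b \<in> E - B \<and> b < a} =
        {(a, b). a \<in> A \<and> b \<in> insert m E - A \<and> b < a}"
      unfolding B(4) using insert(2) B(1) by auto
    finally show ?thesis .
  qed
qed

section \<open>Formal sums and Plucker relations\<close>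

lemma formal_sum_cong:
  "(\<And>x. x \<in> A \<Longrightarrow> f x = g x) \<Longrightarrow> formal_sum f A = formal_sum g A"
proof -
  assume eq: "\<And>x. x \<in> A \<Longrightarrow> f x = g x"
  then have "{x \<in> A. f x \<noteq> None} = {x \<in> A. g x \<noteq> None}" by auto
  moreover have "image_mset (\<lambda>x. the (f x)) (mset_set B) = image_mset (\<lambda>x. the (g x)) (mset_set B)"
    if "B \<subseteq> A" for B
    by (cases "finite B") (use eq that in \<open>auto intro!: image_mset_cong\<close>)
  ultimately show ?thesis by (simp add: formal_sum_def)
qed

lemma formal_sum_mono_neutral:
  assumes "finite B" "A \<subseteq> B" "\<And>x. x \<in> B - A \<Longrightarrow> f x = None"
  shows "formal_sum f A = formal_sum f B"
proof -
  have "x \<in> A \<longleftrightarrow> x \<in> B" if "f x \<noteq> None" for x using assms(2,3) that by (metis DiffI subsetD)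
  then have "{x \<in> A. f x \<noteq> None} = {x \<in> B. f x \<noteq> None}" by (auto simp del: not_None_eq)
  then show ?thesis by (simp only: formal_sum_def)
qed

lemma formal_sum_None: "(\<And>x. x \<in> A \<Longrightarrow> f x = None) \<Longrightarrow> formal_sum f A = {#}"
  using formal_sum_cong[of A f "\<lambda>x. None"] by (simp add: formal_sum_def)

lemma formal_sum_reindex:
  assumes "inj_on h A"
  shows "formal_sum f (h ` A) = formal_sum (f \<circ> h) A"
proof -
  have "{x \<in> h ` A. f x \<noteq> None} = h ` {x \<in> A. f (h x) \<noteq> None}" by auto
  moreover have "inj_on h {x \<in> A. f (h x) \<noteq> None}" using assms by (rule inj_on_subset) auto
  ultimately show ?thesis
    by (simp add: formal_sum_def image_mset_mset_set[symmetric] multiset.map_comp comp_def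
        del: not_None_eq)
qed

lemma formal_sum_map_option:
  "formal_sum (\<lambda>x. map_option g (f x)) A = image_mset g (formal_sum f A)"
proof (cases "finite {x \<in> A. f x \<noteq> None}")
  case True
  then show ?thesis
    by (auto simp: formal_sum_def multiset.map_comp comp_def option.map_sel intro!: image_mset_cong)
qed (simp add: formal_sum_def)
lemma set_formal_sum:
  "finite A \<Longrightarrow> set_mset (formal_sum f A) = {a. \<exists>x\<in>A. f x = Some a}"
  by (force simp: formal_sum_def)

section \<open>Arithmetic with the zero adjoined\<close>

lemma mult0_simps [simp]:
  "mult0 F None x = None" "mult0 F x None = None"
  "mult0 F (Some a) (Some b) = Some (a \<otimes>\<^bsub>F\<^esub> b)"
  by (auto simp: mult0_def split: option.split)

lemma mult0_eq_None_iff [simp]: "mult0 F x y = None \<longleftrightarrow> x = None \<or> y = None"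
  by (auto simp: mult0_def split: option.split)

lemma mult0_Some_map_option: "mult0 F (Some c) x = map_option (\<lambda>a. c \<otimes>\<^bsub>F\<^esub> a) x"
  by (cases x) auto

lemma carrier0_simps [simp]: "None \<in> carrier0 F" "Some a \<in> carrier0 F \<longleftrightarrow> a \<in> carrier F"
  by (auto simp: carrier0_def)

lemma invol0_simps [simp]: "invol0 F None = None" "invol0 F (Some a) = Some (invol F a)"
  by (auto simp: invol0_def)

text \<open>Unlike in \<open>orthogonal\<close>, the involution is left out, since a Plucker
  relation carries none. It returns only in the comparison with vectors and covectors.\<close>

definition pairing :: "'a tract \<Rightarrow> 'e set \<Rightarrow> ('e \<Rightarrow> 'a option) \<Rightarrow> ('e \<Rightarrow> 'a option) \<Rightarrow> 'a multiset" where
  "pairing F E X Y = formal_sum (\<lambda>i. mult0 F (X i) (Y i)) E"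

text \<open>Agrees with \<open>circuit_vector\<close> on \<open>E\<close>, but is a total function
  that does not mention \<open>E\<close>.\<close>

definition circ :: "'a tract \<Rightarrow> ('e::linorder set \<Rightarrow> 'a option) \<Rightarrow> 'e set \<Rightarrow> 'e \<Rightarrow> 'a option" where
  "circ F P J j = (if j \<in> J
    then mult0 F (sign0 F ((-1) ^ card {i \<in> J. i < j})) (P (J - {j})) else None)"

text \<open>A cocircuit, if it is nonzero: up to one sign and the involution it is a circuit vector
  of the dual, see \<open>circuit_vector_dual_plucker\<close>.\<close>

definition cocirc :: "'a tract \<Rightarrow> ('e::linorder set \<Rightarrow> 'a option) \<Rightarrow> 'e set \<Rightarrow> 'e \<Rightarrow> 'a option" where
  "cocirc F P I j = (if j \<in> I then None
    else mult0 F (sign0 F ((-1) ^ card {i \<in> I. i < j})) (P (insert j I)))"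

lemma pairing_cong:
  "(\<And>i. i \<in> E \<Longrightarrow> mult0 F (X i) (Y i) = mult0 F (X' i) (Y' i)) \<Longrightarrow>
    pairing F E X Y = pairing F E X' Y'"
  unfolding pairing_def by (rule formal_sum_cong)

section \<open>Signs, scaling and the involution in a tract\<close>

context tract
begin

lemma neg_one: "neg_one F \<in> carrier F" "{#\<one>, neg_one F#} \<in> null F"
  using theI'[OF ex1_neg_one] by (simp_all add: neg_one_def)

lemma neg_one_unique: "e \<in> carrier F \<Longrightarrow> {#\<one>, e#} \<in> null F \<Longrightarrow> e = neg_one F"
  using ex1_neg_one neg_one by blast

text \<open>Scaling \<open>1 + (-1)\<close> by the inverse of \<open>-1\<close> gives a null sum of
  that inverse and \<open>1\<close>, so uniqueness of \<open>-1\<close> makes it its own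
  inverse.\<close>

lemma neg_one_square: "neg_one F \<otimes> neg_one F = \<one>"
proof -
  have "{#inv neg_one F, \<one>#} \<in> null F"
    using null_scale[OF neg_one(2), of "inv neg_one F"] neg_one(1) by simp
  then have "inv neg_one F = neg_one F"
    using neg_one(1) by (intro neg_one_unique) (simp_all add: add_mset_commute)
  then show ?thesis using neg_one(1) r_inv[of "neg_one F"] by simp
qed

lemma invol_closed [simp]: "a \<in> carrier F \<Longrightarrow> invol F a \<in> carrier F"
  and invol_mult: "a \<in> carrier F \<Longrightarrow> b \<in> carrier F \<Longrightarrow> invol F (a \<otimes> b) = invol F a \<otimes> invol F b"
  and invol_null: "S \<in> null F \<Longrightarrow> image_mset (invol F) S \<in> null F"
  using invol_hom by (auto simp: tract_hom_def hom_def)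

lemma invol_one [simp]: "invol F \<one> = \<one>"
  using invol_mult[of \<one> \<one>] invol_closed[of \<one>] l_cancel_one by fastforce

lemma invol_neg_one [simp]: "invol F (neg_one F) = neg_one F"
  using invol_null[OF neg_one(2)] by (intro neg_one_unique) (simp_all add: neg_one)

lemma mult0_closed [simp]: "x \<in> carrier0 F \<Longrightarrow> y \<in> carrier0 F \<Longrightarrow> mult0 F x y \<in> carrier0 F"
  by (auto simp: carrier0_def)

lemma mult0_assoc:
  "x \<in> carrier0 F \<Longrightarrow> y \<in> carrier0 F \<Longrightarrow> z \<in> carrier0 F \<Longrightarrow>
    mult0 F (mult0 F x y) z = mult0 F x (mult0 F y z)"
  by (auto simp: carrier0_def m_assoc)

lemma mult0_commute:
  "x \<in> carrier0 F \<Longrightarrow> y \<in> carrier0 F \<Longrightarrow> mult0 F x y = mult0 F y x"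
  by (auto simp: carrier0_def m_comm)

lemma mult0_left_commute:
  "x \<in> carrier0 F \<Longrightarrow> y \<in> carrier0 F \<Longrightarrow> z \<in> carrier0 F \<Longrightarrow>
    mult0 F x (mult0 F y z) = mult0 F y (mult0 F x z)"
  by (auto simp: carrier0_def m_lcomm)

lemmas mult0_ac = mult0_assoc mult0_commute mult0_left_commute

lemma invol0_closed [simp]: "x \<in> carrier0 F \<Longrightarrow> invol0 F x \<in> carrier0 F"
  by (auto simp: carrier0_def)

lemma invol0_invol0 [simp]: "x \<in> carrier0 F \<Longrightarrow> invol0 F (invol0 F x) = x"
  by (auto simp: carrier0_def invol_invol)

lemma invol0_mult0:
  "x \<in> carrier0 F \<Longrightarrow> y \<in> carrier0 F \<Longrightarrow> invol0 F (mult0 F x y) = mult0 F (invol0 F x) (invol0 F y)"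
  by (auto simp: carrier0_def invol_mult)

lemma sign0_closed [simp]: "sign0 F s \<in> carrier0 F"
  by (simp add: sign0_def neg_one)

lemma invol0_sign0 [simp]: "invol0 F (sign0 F s) = sign0 F s"
  by (simp add: sign0_def)

lemma sign0_mult:
  "s \<in> {1, -1} \<Longrightarrow> t \<in> {1, -1} \<Longrightarrow> mult0 F (sign0 F s) (sign0 F t) = sign0 F (s * t)"
  by (auto simp: sign0_def neg_one neg_one_square)

lemma sign0_mult_power:
  "mult0 F (sign0 F ((-1) ^ m)) (sign0 F ((-1) ^ n)) = sign0 F ((-1) ^ (m + n))"
  by (simp add: sign0_mult power_add minus_one_power_iff)

lemma null_scale_iff:
  assumes "set_mset S \<subseteq> carrier F" "c \<in> carrier F"
  shows "image_mset (\<lambda>a. c \<otimes> a) S \<in> null F \<longleftrightarrow> S \<in> null F"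
proof
  assume "image_mset (\<lambda>a. c \<otimes> a) S \<in> null F"
  then have "image_mset (\<lambda>a. inv c \<otimes> a) (image_mset (\<lambda>a. c \<otimes> a) S) \<in> null F"
    using assms(2) by (intro null_scale[of "image_mset (\<lambda>a. c \<otimes> a) S"] inv_closed)
  moreover have "inv c \<otimes> (c \<otimes> a) = a" if "a \<in># S" for a
    using that assms by (simp add: m_assoc[symmetric] subset_iff)
  ultimately show "S \<in> null F"
    by (simp add: multiset.map_comp comp_def cong: multiset.map_cong)
qed (use null_scale assms in auto)

lemma formal_sum_null_scale:
  assumes "finite A" "c \<in> carrier F" "\<And>x. x \<in> A \<Longrightarrow> g x \<in> carrier0 F"
    and "\<And>x. x \<in> A \<Longrightarrow> f x = mult0 F (Some c) (g x)"
  shows "formal_sum f A \<in> null F \<longleftrightarrow> formal_sum g A \<in> null F"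
proof -
  have "formal_sum f A = image_mset (\<lambda>a. c \<otimes> a) (formal_sum g A)"
    using assms(4) by (simp add: mult0_Some_map_option formal_sum_map_option[symmetric] cong: formal_sum_cong)
  moreover have "set_mset (formal_sum g A) \<subseteq> carrier F"
    using assms(1,3) by (force simp: set_formal_sum)
  ultimately show ?thesis using assms(2) by (simp add: null_scale_iff)
qed

lemma formal_sum_null_invol:
  assumes "finite A" "\<And>x. x \<in> A \<Longrightarrow> g x \<in> carrier0 F"
    and "\<And>x. x \<in> A \<Longrightarrow> f x = invol0 F (g x)"
  shows "formal_sum f A \<in> null F \<longleftrightarrow> formal_sum g A \<in> null F"
proof
  have "formal_sum f A = image_mset (invol F) (formal_sum g A)"
    using assms(3) by (simp add: invol0_def formal_sum_map_option[symmetric] cong: formal_sum_cong)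
  then show "formal_sum f A \<in> null F" if "formal_sum g A \<in> null F"
    using that invol_null by simp
  have "formal_sum g A = formal_sum (\<lambda>x. invol0 F (f x)) A"
    using assms by (intro formal_sum_cong) simp
  also have "\<dots> = image_mset (invol F) (formal_sum f A)"
    by (simp add: invol0_def formal_sum_map_option)
  finally show "formal_sum g A \<in> null F" if "formal_sum f A \<in> null F"
    using that invol_null by simp
qed

lemma circ_closed:
  assumes "finite E" "P \<in> nsets E r \<rightarrow>\<^sub>E carrier0 F" "J \<in> nsets E (r + 1)"
  shows "circ F P J j \<in> carrier0 F"
proof (cases "j \<in> J")
  case True
  then have "J - {j} \<in> nsets E r" using assms(3) by (auto simp: nsets_def)
  then show ?thesis using True PiE_mem[OF assms(2)] by (simp add: circ_def)
qed (simp add: circ_def)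

lemma cocirc_closed:
  assumes "finite E" "P \<in> nsets E r \<rightarrow>\<^sub>E carrier0 F" "I \<subseteq> E" "card I + 1 = r" "j \<in> E"
  shows "cocirc F P I j \<in> carrier0 F"
proof (cases "j \<in> I")
  case False
  moreover have "finite I" using assms finite_subset by auto
  ultimately have "insert j I \<in> nsets E r" using assms by (auto simp: nsets_def)
  then show ?thesis using False PiE_mem[OF assms(2)] by (simp add: cocirc_def)
qed (simp add: cocirc_def)

text \<open>
  Counting the elements on either side of \<open>j\<close> turns the sign of the Plucker relation into the
  product of the signs of a circuit and of a cocircuit, up to a global sign.
\<close>

lemma plucker_term:
  assumes fin: "finite I" "finite J" and card: "card J = card I + 2" and j: "j \<in> J - I"
    and pq: "p \<in> carrier0 F" "q \<in> carrier0 F"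
  shows "mult0 F (sign0 F (plucker_sign j I J)) (mult0 F p q) =
    mult0 F (Some (neg_one F)) (mult0 F (mult0 F (sign0 F ((-1) ^ card {i \<in> J. i < j})) q)
      (mult0 F (sign0 F ((-1) ^ card {i \<in> I. i < j})) p))"
proof -
  have "card J = card {i \<in> J. i < j} + card {i \<in> J. j < i} + 1"
  proof -
    have "J = insert j ({i \<in> J. i < j} \<union> {i \<in> J. j < i})" using j by auto
    also have "card \<dots> = card {i \<in> J. i < j} + card {i \<in> J. j < i} + 1"
      using fin by (subst card_insert_disjoint, simp, simp, subst card_Un_disjoint) auto
    finally show ?thesis .
  qed
  moreover have "card I = card {i \<in> I. i < j} + card {i \<in> I. j < i}"
  proof -
    have "i < j \<or> j < i" if "i \<in> I" for i using that j by (metis DiffE neqE)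
    then have "I = {i \<in> I. i < j} \<union> {i \<in> I. j < i}" by auto
    also have "card \<dots> = card {i \<in> I. i < j} + card {i \<in> I. j < i}"
      using fin by (intro card_Un_disjoint) auto
    finally show ?thesis .
  qed
  ultimately have "(card {i \<in> J. i < j} + card {i \<in> I. i < j}) +
      (card {i \<in> J. j < i} + card {i \<in> I. j < i}) = 2 * card I + 1"
    using card by simp
  then have "even (card {i \<in> J. i < j} + card {i \<in> I. i < j}) \<longleftrightarrow>
      odd (card {i \<in> J. j < i} + card {i \<in> I. j < i})"
    by presburger
  then have sgn: "plucker_sign j I J =
      (-1) * (-1) ^ (card {i \<in> J. i < j} + card {i \<in> I. i < j})"
    by (auto simp: plucker_sign_def minus_one_power_iff)
  have "sign0 F (plucker_sign j I J) = mult0 F (sign0 F (-1))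
      (mult0 F (sign0 F ((-1) ^ card {i \<in> J. i < j})) (sign0 F ((-1) ^ card {i \<in> I. i < j})))"
    unfolding sgn sign0_mult_power by (rule sign0_mult[symmetric]) (auto simp: minus_one_power_iff)
  moreover have "sign0 F (-1) = Some (neg_one F)" by (simp add: sign0_def)
  ultimately show ?thesis
    using pq by (simp add: mult0_ac neg_one)
qed

text \<open>The terms of the Plucker relation and of the pairing differ by the common factor
  \<open>neg_one F\<close>, which does not affect being null, and the terms of the pairing vanish
  outside \<open>J - I\<close>. Plucker relations thus become orthogonality of circuits and
  cocircuits.\<close>

lemma plucker_vector_iff:
  assumes "finite E"
  shows "plucker_vector F E r P \<longleftrightarrow>
    P \<in> nsets E r \<rightarrow>\<^sub>E carrier0 F \<and> (\<exists>I \<in> nsets E r. P I \<noteq> None) \<and>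
    (\<forall>I J. I \<subseteq> E \<longrightarrow> card I + 1 = r \<longrightarrow> J \<in> nsets E (r + 1) \<longrightarrow>
      pairing F E (circ F P J) (cocirc F P I) \<in> null F)"
proof -
  have "formal_sum (\<lambda>j. mult0 F (sign0 F (plucker_sign j I J))
        (mult0 F (P (insert j I)) (P (J - {j})))) (J - I) \<in> null F \<longleftrightarrow>
      pairing F E (circ F P J) (cocirc F P I) \<in> null F"
    if P: "P \<in> nsets E r \<rightarrow>\<^sub>E carrier0 F" and I: "I \<subseteq> E" "card I + 1 = r" and J: "J \<in> nsets E (r + 1)"
    for I J
  proof -
    have JE: "J - I \<subseteq> E" using J by (auto simp: nsets_def)
    have "pairing F E (circ F P J) (cocirc F P I) =
        formal_sum (\<lambda>j. mult0 F (circ F P J j) (cocirc F P I j)) (J - I)"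
      unfolding pairing_def
      by (rule formal_sum_mono_neutral[symmetric, OF assms JE]) (auto simp: circ_def cocirc_def)
    then show ?thesis
    proof (simp only:, intro formal_sum_null_scale[where c = "neg_one F"])
      show "finite (J - I)" using JE assms finite_subset by blast
      fix j assume j: "j \<in> J - I"
      show "mult0 F (circ F P J j) (cocirc F P I j) \<in> carrier0 F"
        using j JE circ_closed[OF assms P J] cocirc_closed[OF assms P I] by auto
      have fin: "finite I" "finite J" using I J assms finite_subset by (auto simp: nsets_def)
      then have "insert j I \<in> nsets E r" "J - {j} \<in> nsets E r" and "card J = card I + 2"
        using j I J by (auto simp: nsets_def)
      then show "mult0 F (sign0 F (plucker_sign j I J)) (mult0 F (P (insert j I)) (P (J - {j}))) =
          mult0 F (Some (neg_one F)) (mult0 F (circ F P J j) (cocirc F P I j))"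
        using plucker_term[OF fin _ j] PiE_mem[OF P] j by (simp add: circ_def cocirc_def)
    qed (rule neg_one)
  qed
  then show ?thesis unfolding plucker_vector_def by (intro conj_cong refl) simp
qed

end

text \<open>Scaling by the identity puts \<open>P\<close> into its own class. Only closure and the
  left unit law are assumed, so that the equivalence applies to \<open>F\<close> and to the record
  \<open>tropical_extension F\<close> alike.\<close>

lemma ex_matroid_iff:
  assumes one: "\<one>\<^bsub>F\<^esub> \<in> carrier F" "\<And>a. a \<in> carrier F \<Longrightarrow> \<one>\<^bsub>F\<^esub> \<otimes>\<^bsub>F\<^esub> a = a"
  shows "(\<exists>M \<in> matroids F E r. P \<in> M) \<longleftrightarrow> plucker_vector F E r P"
proof
  assume P: "plucker_vector F E r P"
  have "scale F (nsets E r) \<one>\<^bsub>F\<^esub> P = P"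
  proof
    fix B
    show "scale F (nsets E r) \<one>\<^bsub>F\<^esub> P B = P B"
      using P one by (cases "P B") (auto simp: plucker_vector_def scale_def PiE_def extensional_def
          Pi_def carrier0_def split: if_splits)
  qed
  then have "(P, P) \<in> plucker_equiv F E r"
    using P one(1) by (auto simp: plucker_equiv_def intro!: bexI[of _ "\<one>\<^bsub>F\<^esub>"])
  then show "\<exists>M \<in> matroids F E r. P \<in> M"
    using P by (auto simp: matroids_def quotient_def)
qed (auto simp: matroids_def quotient_def plucker_equiv_def)

section \<open>Orthogonality of vectors and covectors\<close>

text \<open>Taking \<open>i\<close> out of \<open>T\<close> destroys the inversions
  \<open>(i, b)\<close> and creates the inversions \<open>(a, i)\<close> with \<open>i < a\<close>;
  the two unions in the proof express this. The first factor on the right is independent of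
  \<open>i\<close> and becomes a global sign for a circuit of the dual.\<close>

lemma complement_sign_remove:
  fixes E :: "'e::linorder set"
  assumes "finite E" "T \<subseteq> E" "i \<in> T"
  shows "(-1) ^ card {y \<in> T. y < i} * complement_sign E (T - {i}) =
    (-1) ^ (card {(a, b). a \<in> T \<and> b \<in> E - T \<and> b < a} + card T + 1) *
      (-1) ^ card {y \<in> E - T. y < i}"
proof -
  have fin: "finite T" using assms finite_subset by blast
  let ?K = "{(a, b). a \<in> T \<and> b \<in> E - T \<and> b < a}"
  let ?N = "{(a, b). a \<in> T - {i} \<and> b \<in> E - (T - {i}) \<and> b < a}"
  have finKN: "finite ?K" "finite ?N"
    by (rule finite_subset[of _ "E \<times> E"], use assms in force, use assms in force)+
  have "?N \<union> {i} \<times> {y \<in> E - T. y < i} = ?K \<union> {a \<in> T. i < a} \<times> {i}"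
    using assms by auto
  moreover have "card (?N \<union> {i} \<times> {y \<in> E - T. y < i}) = card ?N + card {y \<in> E - T. y < i}"
    using finKN assms(1) by (subst card_Un_disjoint) (auto simp: card_cartesian_product)
  moreover have "card (?K \<union> {a \<in> T. i < a} \<times> {i}) = card ?K + card {a \<in> T. i < a}"
    using finKN fin assms(3) by (subst card_Un_disjoint) (auto simp: card_cartesian_product)
  ultimately have 1: "card ?N + card {y \<in> E - T. y < i} = card ?K + card {a \<in> T. i < a}"
    by simp
  have 2: "card T = card {y \<in> T. y < i} + card {a \<in> T. i < a} + 1"
  proof -
    have "T = insert i ({y \<in> T. y < i} \<union> {a \<in> T. i < a})" using assms(3) by auto
    also have "card \<dots> = card {y \<in> T. y < i} + card {a \<in> T. i < a} + 1"
      using fin by (subst card_insert_disjoint, simp, simp, subst card_Un_disjoint) auto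
    finally show ?thesis .
  qed
  have "complement_sign E (T - {i}) = (-1) ^ card ?N"
    by (rule complement_sign_eq) (use assms in auto)
  moreover have "even (card {y \<in> T. y < i} + card ?N) \<longleftrightarrow>
      even ((card ?K + card T + 1) + card {y \<in> E - T. y < i})"
  proof -
    have "even (b + n) \<longleftrightarrow> even ((k + t + 1) + c)" if "n + c = k + d" "t = b + d + 1"
      for b n k t c d :: nat
      using that by presburger
    from this[OF 1 2] show ?thesis .
  qed
  then have "(-1 :: int) ^ (card {y \<in> T. y < i} + card ?N) =
      (-1) ^ ((card ?K + card T + 1) + card {y \<in> E - T. y < i})"
    by (simp only: minus_one_power_iff)
  ultimately show ?thesis by (simp only: power_add)
qed

context tract
begin

text \<open>The sign in front does not depend on \<open>i\<close>. Hence being orthogonal to a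
  circuit of the dual supported in \<open>T\<close> means pairing to a null sum with the cocircuit
  of \<open>E - T\<close>.\<close>

lemma circuit_vector_dual_plucker:
  assumes "finite E" "r \<le> card E" "P \<in> nsets E r \<rightarrow>\<^sub>E carrier0 F" "T \<in> nsets E (card E - r + 1)" "i \<in> E"
  shows "circuit_vector F E (dual_plucker F E r P) T i =
    mult0 F (sign0 F ((-1) ^ (card {(a, b). a \<in> T \<and> b \<in> E - T \<and> b < a} + card T + 1)))
      (invol0 F (cocirc F P (E - T) i))"
proof (cases "i \<in> T")
  case True
  have T: "T \<subseteq> E" "finite T" "card T = card E - r + 1" using assms(4) by (auto simp: nsets_def)
  let ?k = "card {(a, b). a \<in> T \<and> b \<in> E - T \<and> b < a} + card T + 1"
  have ins: "E - (T - {i}) = insert i (E - T)" using assms(5) by auto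
  have "T - {i} \<in> nsets E (card E - r)" using True T by (auto simp: nsets_def)
  moreover have "insert i (E - T) \<in> nsets E r"
    using True T assms card_mono[OF assms(1) T(1)] by (auto simp: nsets_def card_Diff_subset)
  then have P: "P (insert i (E - T)) \<in> carrier0 F" by (rule PiE_mem[OF assms(3)])
  moreover have "mult0 F (sign0 F ((-1) ^ card {y \<in> T. y < i})) (sign0 F (complement_sign E (T - {i}))) =
      mult0 F (sign0 F ((-1) ^ ?k)) (sign0 F ((-1) ^ card {y \<in> E - T. y < i}))"
    using complement_sign_remove[OF assms(1) T(1) True]
    by (subst (1 2) sign0_mult) (auto simp: complement_sign_def sign_def minus_one_power_iff)
  ultimately show ?thesis
    using True assms(5)
    by (simp add: circuit_vector_def cocirc_def dual_plucker_def ins invol0_mult0 mult0_assoc[symmetric])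
qed (simp add: circuit_vector_def cocirc_def assms(5))

end

section \<open>Perfection as a statement about pairings\<close>

context perfect_tract
begin

text \<open>\<open>X\<close> is a vector of the matroid of \<open>P\<close>, the involution of
  \<open>Y\<close> is a covector, and perfection makes them orthogonal. The ground set consists of
  natural numbers because \<open>perfect\<close> is stated for these.\<close>

lemma vector_covector_pairing_nat:
  fixes E :: "nat set"
  assumes E: "finite E" and P: "plucker_vector F E r P"
    and X: "\<And>i. i \<in> E \<Longrightarrow> X i \<in> carrier0 F" and Y: "\<And>i. i \<in> E \<Longrightarrow> Y i \<in> carrier0 F"
    and XI: "\<And>I. I \<subseteq> E \<Longrightarrow> card I + 1 = r \<Longrightarrow> pairing F E X (cocirc F P I) \<in> null F"
    and YJ: "\<And>J. J \<in> nsets E (r + 1) \<Longrightarrow> pairing F E (circ F P J) Y \<in> null F"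
  shows "pairing F E X Y \<in> null F"
proof -
  define M where "M = plucker_equiv F E r `` {P}"
  have M: "M \<in> matroids F E r" using P by (auto simp: M_def matroids_def intro: quotientI)
  have Pc: "P \<in> nsets E r \<rightarrow>\<^sub>E carrier0 F" and ne: "\<exists>B\<in>nsets E r. P B \<noteq> None"
    using P E by (auto simp: plucker_vector_iff)
  have r: "r \<le> card E" using ne E by (auto simp: nsets_def intro: card_mono)
  \<comment> \<open>Members of the class \<open>M\<close> are multiples of \<open>P\<close>, so
    their circuits and cocircuits change only by the scalar \<open>d\<close>.\<close>
  have scaled: "Q \<in> nsets E r \<rightarrow>\<^sub>E carrier0 F \<and> (\<exists>d\<in>carrier F. \<forall>B\<in>nsets E r. Q B = mult0 F (Some d) (P B))"
    if "Q \<in> M" for Q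
    using that E by (auto simp: M_def plucker_equiv_def scale_def plucker_vector_iff)
  \<comment> \<open>With \<open>Y\<close> conjugated, the products in
    \<open>orthogonal F E Y' Z\<close> are involutions of products in a pairing. The restriction to
    \<open>E\<close> is there because \<open>perp\<close> consists of extensional functions.\<close>
  define X' Y' where "X' = (\<lambda>i\<in>E. X i)" and "Y' = (\<lambda>i\<in>E. invol0 F (Y i))"
  have "Y' \<in> covectors F E r M"
    unfolding covectors_def perp_def
  proof (intro CollectI conjI ballI)
    show "Y' \<in> E \<rightarrow>\<^sub>E carrier0 F" using Y by (auto simp: Y'_def)
    fix Z assume "Z \<in> circuits F E r M"
    then obtain c Q T where Z: "Z = scale F E c (circuit_vector F E Q T)" and c: "c \<in> carrier F"
      and Q: "Q \<in> M" and T: "T \<in> nsets E (r + 1)"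
      by (auto simp: circuits_def)
    obtain d where d: "d \<in> carrier F" "\<forall>B\<in>nsets E r. Q B = mult0 F (Some d) (P B)"
      using scaled[OF Q] by blast
    have Zi: "Z i = mult0 F (Some (c \<otimes> d)) (circ F P T i)" if "i \<in> E" for i
    proof (cases "i \<in> T")
      case True
      then have "T - {i} \<in> nsets E r" using T by (auto simp: nsets_def)
      then show ?thesis using True that d PiE_mem[OF Pc] c
        by (simp add: Z scale_def circuit_vector_def circ_def mult0_assoc mult0_left_commute
            del: mult0_simps(3) flip: mult0_simps(3))
    qed (use that in \<open>simp add: Z scale_def circuit_vector_def circ_def\<close>)
    have cl: "circ F P T i \<in> carrier0 F" for i by (rule circ_closed[OF E Pc T])
    let ?f = "\<lambda>i. mult0 F (Some (c \<otimes> d)) (mult0 F (circ F P T i) (Y i))"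
    have "formal_sum (\<lambda>i. mult0 F (Y' i) (invol0 F (Z i))) E \<in> null F \<longleftrightarrow> formal_sum ?f E \<in> null F"
    proof (rule formal_sum_null_invol[OF E])
      fix i assume i: "i \<in> E"
      show "?f i \<in> carrier0 F" using c d cl Y i by simp
      show "mult0 F (Y' i) (invol0 F (Z i)) = invol0 F (?f i)"
        using c d cl Y[OF i] i by (simp add: Zi Y'_def invol0_mult0 mult0_ac del: mult0_simps(3))
    qed
    also have "\<dots> \<longleftrightarrow> pairing F E (circ F P T) Y \<in> null F"
      unfolding pairing_def
      by (rule formal_sum_null_scale[OF E]) (use c d cl Y in auto)
    finally show "orthogonal F E Y' Z" using YJ[OF T] by (simp add: orthogonal_def)
  qed
  then have Y': "Y' \<in> perp F E (vectors F E r M)" using perfect[OF E M] by simp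
  have "X' \<in> vectors F E r M"
    unfolding vectors_def perp_def
  proof (intro CollectI conjI ballI)
    show "X' \<in> E \<rightarrow>\<^sub>E carrier0 F" using X by (auto simp: X'_def)
    fix Z assume "Z \<in> circuits F E (card E - r) (dual F E r M)"
    then obtain c Q T where Z: "Z = scale F E c (circuit_vector F E (dual_plucker F E r Q) T)"
      and c: "c \<in> carrier F" and Q: "Q \<in> M" and T: "T \<in> nsets E (card E - r + 1)"
      by (auto simp: circuits_def dual_def)
    obtain d where Qc: "Q \<in> nsets E r \<rightarrow>\<^sub>E carrier0 F"
      and d: "d \<in> carrier F" "\<forall>B\<in>nsets E r. Q B = mult0 F (Some d) (P B)"
      using scaled[OF Q] by blast
    obtain s where s: "s \<in> carrier F" and circ: "\<And>i. i \<in> E \<Longrightarrow>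
        circuit_vector F E (dual_plucker F E r Q) T i = mult0 F (Some s) (invol0 F (cocirc F Q (E - T) i))"
      using that circuit_vector_dual_plucker[OF E r Qc T, unfolded sign0_def]
        sign0_closed[unfolded sign0_def carrier0_simps] by blast
    have T': "T \<subseteq> E" "finite T" "card T = card E - r + 1" using T by (auto simp: nsets_def)
    have I: "E - T \<subseteq> E" "card (E - T) + 1 = r"
      using T' r card_mono[OF E T'(1)] by (auto simp: card_Diff_subset)
    have cl: "cocirc F P (E - T) i \<in> carrier0 F" if "i \<in> E" for i
      by (rule cocirc_closed[OF E Pc I that])
    have co: "cocirc F Q (E - T) i = mult0 F (Some d) (cocirc F P (E - T) i)" if "i \<in> E" for i
    proof (cases "i \<in> T")
      case True
      then have "insert i (E - T) \<in> nsets E r" using I E that by (auto simp: nsets_def)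
      then show ?thesis using True d PiE_mem[OF Pc]
        by (simp add: cocirc_def mult0_left_commute)
    qed (use that in \<open>simp add: cocirc_def\<close>)
    have Zi: "invol0 F (Z i) = mult0 F (Some (invol F c \<otimes> (invol F s \<otimes> d))) (cocirc F P (E - T) i)"
      if i: "i \<in> E" for i
      using c s d cl[OF i] i
      by (simp add: Z scale_def circ co invol0_mult0 mult0_assoc invol_invol
          del: mult0_simps(3) flip: mult0_simps(3))
    have "formal_sum (\<lambda>i. mult0 F (X' i) (invol0 F (Z i))) E \<in> null F \<longleftrightarrow>
        pairing F E X (cocirc F P (E - T)) \<in> null F"
      unfolding pairing_def
    proof (rule formal_sum_null_scale[OF E])
      fix i assume i: "i \<in> E"
      show "mult0 F (X i) (cocirc F P (E - T) i) \<in> carrier0 F" using X cl i by simp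
      show "mult0 F (X' i) (invol0 F (Z i)) =
          mult0 F (Some (invol F c \<otimes> (invol F s \<otimes> d))) (mult0 F (X i) (cocirc F P (E - T) i))"
        using c s d cl[OF i] X[OF i] i by (simp add: Zi X'_def mult0_left_commute del: mult0_simps(3))
    qed (use c s d in simp)
    then show "orthogonal F E X' Z" using XI[OF I] by (simp add: orthogonal_def)
  qed
  then have "orthogonal F E Y' X'" using Y' by (simp add: perp_def)
  moreover have "formal_sum (\<lambda>i. mult0 F (Y' i) (invol0 F (X' i))) E \<in> null F \<longleftrightarrow>
      pairing F E X Y \<in> null F"
    unfolding pairing_def
    by (rule formal_sum_null_invol[OF E]) (use X Y in \<open>auto simp: X'_def Y'_def invol0_mult0 mult0_commute\<close>)
  ultimately show ?thesis by (simp add: orthogonal_def)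
qed

text \<open>The map \<open>h\<close> sends an element to its position in \<open>E\<close>, which
  transports the claim to natural numbers. The signs of circuits and cocircuits count smaller
  elements, so an order isomorphism preserves them.\<close>

lemma vector_covector_pairing:
  fixes E :: "'e::linorder set"
  assumes E: "finite E" and P: "plucker_vector F E r P"
    and X: "\<And>i. i \<in> E \<Longrightarrow> X i \<in> carrier0 F" and Y: "\<And>i. i \<in> E \<Longrightarrow> Y i \<in> carrier0 F"
    and XI: "\<And>I. I \<subseteq> E \<Longrightarrow> card I + 1 = r \<Longrightarrow> pairing F E X (cocirc F P I) \<in> null F"
    and YJ: "\<And>J. J \<in> nsets E (r + 1) \<Longrightarrow> pairing F E (circ F P J) Y \<in> null F"
  shows "pairing F E X Y \<in> null F"
proof -
  define h where "h x = card {y \<in> E. y < x}" for x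
  have mono: "h x < h y" if "x < y" "x \<in> E" for x y
    unfolding h_def using that E by (intro psubset_card_mono) auto
  have less: "h x < h y \<longleftrightarrow> x < y" if "x \<in> E" "y \<in> E" for x y
    using mono[of x y] mono[of y x] that by (metis less_asym neqE)
  have inj: "inj_on h E" using less by (metis inj_onI less_irrefl neqE)
  define g where "g = inv_into E h"
  have gh: "g (h x) = x" if "x \<in> E" for x using that inj by (simp add: g_def)
  have gh_image: "g ` h ` B = B" if "B \<subseteq> E" for B
    unfolding g_def using inj that by (rule inv_into_image_cancel)
  have hg_image: "\<exists>B\<subseteq>E. B' = h ` B" if "B' \<subseteq> h ` E" for B'
    using that by (auto simp: subset_image_iff)
  have card: "card (h ` B) = card B" if "B \<subseteq> E" for B
    using that inj by (meson card_image inj_on_subset)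
  have nsets: "h ` B \<in> nsets (h ` E) n \<longleftrightarrow> B \<in> nsets E n" if "B \<subseteq> E" for B n
    using that card[OF that] E finite_subset[OF that] by (auto simp: nsets_def)
  have nsetsE: "\<exists>B\<in>nsets E n. B' = h ` B" if "B' \<in> nsets (h ` E) n" for B' n
    using hg_image[of B'] that nsets by (auto simp: nsets_def)
  define P' where "P' = (\<lambda>B\<in>nsets (h ` E) r. P (g ` B))"
  have P': "P' (h ` B) = P B" if "B \<in> nsets E r" for B
  proof -
    have "B \<subseteq> E" using that by (auto simp: nsets_def)
    then show ?thesis using that nsets gh_image by (simp add: P'_def)
  qed
  have cnt: "card {i \<in> h ` B. i < h j} = card {i \<in> B. i < j}" if "B \<subseteq> E" "j \<in> E" for B j
  proof -
    have "{i \<in> h ` B. i < h j} = h ` {i \<in> B. i < j}" using less that by auto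
    then show ?thesis using that by (subst card[symmetric]) auto
  qed
  have mem: "h j \<in> h ` B \<longleftrightarrow> j \<in> B" if "B \<subseteq> E" "j \<in> E" for B j
    using inj that by (auto dest: inj_onD)
  have circ': "circ F P' (h ` J) (h j) = circ F P J j" if "J \<in> nsets E (r + 1)" "j \<in> E" for J j
  proof (cases "j \<in> J")
    case True
    have J: "J \<subseteq> E" using that by (auto simp: nsets_def)
    have "h ` J - {h j} = h ` (J - {j})"
      using inj_on_image_set_diff[OF inj, of J "{j}"] J that(2) by auto
    moreover have "J - {j} \<in> nsets E r" using True that by (auto simp: nsets_def)
    ultimately show ?thesis using True J that(2) P' by (simp add: circ_def cnt)
  next
    case False
    moreover have "J \<subseteq> E" using that by (auto simp: nsets_def)
    ultimately show ?thesis using mem[of J j] that(2) by (simp add: circ_def)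
  qed
  have cocirc': "cocirc F P' (h ` I) (h j) = cocirc F P I j"
    if "I \<subseteq> E" "card I + 1 = r" "j \<in> E" for I j
  proof (cases "j \<in> I")
    case False
    have "insert (h j) (h ` I) = h ` insert j I" by simp
    moreover have "insert j I \<in> nsets E r"
      using False that finite_subset[OF that(1) E] by (auto simp: nsets_def)
    ultimately show ?thesis using False that mem[of I j] P' by (simp only: cocirc_def cnt if_False)
  qed (use mem[of I j] that in \<open>simp add: cocirc_def\<close>)
  have pairing': "pairing F (h ` E) U V = pairing F E (U \<circ> h) (V \<circ> h)" for U V
    unfolding pairing_def using formal_sum_reindex[OF inj] by (simp add: comp_def)
  have P1: "P \<in> nsets E r \<rightarrow>\<^sub>E carrier0 F" "\<exists>B\<in>nsets E r. P B \<noteq> None"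
    and P2: "\<And>I J. I \<subseteq> E \<Longrightarrow> card I + 1 = r \<Longrightarrow> J \<in> nsets E (r + 1) \<Longrightarrow>
      pairing F E (circ F P J) (cocirc F P I) \<in> null F"
    using P E by (auto simp: plucker_vector_iff)
  have "plucker_vector F (h ` E) r P'"
    unfolding plucker_vector_iff[OF finite_imageI[OF E]]
  proof (intro conjI allI impI)
    show "P' \<in> nsets (h ` E) r \<rightarrow>\<^sub>E carrier0 F"
    proof (rule PiE_I)
      fix B' assume "B' \<in> nsets (h ` E) r"
      then show "P' B' \<in> carrier0 F" using nsetsE P' PiE_mem[OF P1(1)] by metis
    qed (simp add: P'_def)
    show "\<exists>B\<in>nsets (h ` E) r. P' B \<noteq> None"
    proof -
      obtain B where B: "B \<in> nsets E r" "P B \<noteq> None" using P1 by blast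
      then have "B \<subseteq> E" by (auto simp: nsets_def)
      then show ?thesis using B P' nsets by metis
    qed
    fix I' J' assume I': "I' \<subseteq> h ` E" "card I' + 1 = r" and "J' \<in> nsets (h ` E) (r + 1)"
    then obtain I J where IJ: "I \<subseteq> E" "I' = h ` I" "J \<in> nsets E (r + 1)" "J' = h ` J"
      using hg_image[OF I'(1)] nsetsE by metis
    then have I: "card I + 1 = r" using I' card by simp
    show "pairing F (h ` E) (circ F P' J') (cocirc F P' I') \<in> null F"
      unfolding pairing' IJ using P2[OF IJ(1) I IJ(3)] circ'[OF IJ(3)] cocirc'[OF IJ(1) I]
      by (simp cong: pairing_cong)
  qed
  then have "pairing F (h ` E) (X \<circ> g) (Y \<circ> g) \<in> null F"
  proof (rule vector_covector_pairing_nat[OF finite_imageI[OF E]])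
    show "(X \<circ> g) i \<in> carrier0 F" "(Y \<circ> g) i \<in> carrier0 F" if "i \<in> h ` E" for i
      using that X Y gh by auto
    show "pairing F (h ` E) (X \<circ> g) (cocirc F P' I') \<in> null F"
      if I': "I' \<subseteq> h ` E" "card I' + 1 = r" for I'
    proof -
      obtain I where I: "I \<subseteq> E" "I' = h ` I" using hg_image[OF I'(1)] by blast
      then have c: "card I + 1 = r" using I' card by simp
      show ?thesis
        unfolding pairing' I(2) using XI[OF I(1) c] cocirc'[OF I(1) c] gh by (simp cong: pairing_cong)
    qed
    show "pairing F (h ` E) (circ F P' J') (Y \<circ> g) \<in> null F"
      if J': "J' \<in> nsets (h ` E) (r + 1)" for J'
    proof -
      obtain J where J: "J \<in> nsets E (r + 1)" "J' = h ` J" using nsetsE[OF J'] by blast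
      show ?thesis
        unfolding pairing' J(2) using YJ[OF J(1)] circ'[OF J(1)] gh by (simp cong: pairing_cong)
    qed
  qed
  then show ?thesis unfolding pairing' using gh by (simp cong: pairing_cong)
qed

end

section \<open>Leading parts\<close>

lemma val_simps [simp]: "val None = Pinf" "val (Some (a, \<gamma>)) = Fin \<gamma>"
  by (simp_all add: val_def)

text \<open>
  Adding up the \<open>lead c\<close> over a family bounded below by \<open>c\<close> gives the part of lowest level of its formal
  sum, or the zero sum if \<open>c\<close> is not attained.
\<close>

definition lead :: "'g \<Rightarrow> ('a \<times> 'g) option \<Rightarrow> 'a option" where
  "lead c x = (case x of None \<Rightarrow> None | Some (a, \<gamma>) \<Rightarrow> if \<gamma> = c then Some a else None)"

lemma lead_simps [simp]:
  "lead c None = None" "lead c (Some (a, \<gamma>)) = (if \<gamma> = c then Some a else None)"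
  by (simp_all add: lead_def)

lemma lead_eq_Some_iff: "lead c x = Some a \<longleftrightarrow> x = Some (a, c)"
  by (auto simp: lead_def split: option.split if_splits)

lemma lead_eq_None_iff: "lead c x = None \<longleftrightarrow> val x \<noteq> Fin c"
  by (auto simp: lead_def val_def split: option.split if_splits)

lemma lead_eq_None: "Fin c < val x \<Longrightarrow> lead c x = None"
  by (auto simp: lead_eq_None_iff)

section \<open>Products and null sums of the tropical extension in terms of leading parts\<close>

lemma carrier_tropical [simp]: "(a, \<gamma>) \<in> carrier (tropical_extension F) \<longleftrightarrow> a \<in> carrier F"
  by (simp add: tropical_extension_def)

lemma mult_tropical [simp]:
  "(a, \<gamma>) \<otimes>\<^bsub>tropical_extension F\<^esub> (b, \<delta>) = (a \<otimes>\<^bsub>F\<^esub> b, \<gamma> + \<delta>)"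
  by (simp add: tropical_extension_def)

lemma one_tropical: "\<one>\<^bsub>tropical_extension F\<^esub> = (\<one>\<^bsub>F\<^esub>, 0)"
  by (simp add: tropical_extension_def)

lemma lead_closed [simp]: "x \<in> carrier0 (tropical_extension F) \<Longrightarrow> lead c x \<in> carrier0 F"
  by (cases x) (auto simp: carrier0_def tropical_extension_def)

lemma val_mult0: "val (mult0 (tropical_extension F) x y) = val x + val y"
  by (cases x; cases y) (auto simp: val_def)

text \<open>The factors have values at least \<open>c\<close> and \<open>d\<close>, so the product
  reaches \<open>c + d\<close> only if both bounds are attained.\<close>

lemma lead_mult0:
  fixes c d :: "'g::linordered_ab_group_add"
  assumes "Fin c \<le> val x" "Fin d \<le> val y"
  shows "lead (c + d) (mult0 (tropical_extension F) x y) = mult0 F (lead c x) (lead d y)"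
proof (cases x; cases y)
  fix p q assume x: "x = Some p" and y: "y = Some q"
  obtain a \<gamma> b \<delta> where "p = (a, \<gamma>)" "q = (b, \<delta>)" by fastforce
  moreover from this have "c \<le> \<gamma>" "d \<le> \<delta>" using assms x y by auto
  then have "\<gamma> + \<delta> = c + d \<longleftrightarrow> \<gamma> = c \<and> \<delta> = d"
    by (metis add_le_less_mono add_less_le_mono less_irrefl order_le_less)
  ultimately show ?thesis using x y by auto
qed auto

text \<open>The lower bound \<open>c\<close> is attained at \<open>x0\<close>, so the terms selected
  by the null set of the extension are precisely those of value \<open>c\<close>.\<close>

lemma lead_part_formal_sum:
  assumes "finite A" "\<And>x. x \<in> A \<Longrightarrow> Fin c \<le> val (f x)" "x0 \<in> A" "val (f x0) = Fin c"
  defines "S \<equiv> formal_sum f A"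
  shows "image_mset fst (filter_mset (\<lambda>x. \<forall>y \<in># S. snd x \<le> snd y) S) =
    formal_sum (\<lambda>x. lead c (f x)) A"
proof -
  have S: "set_mset S = {p. \<exists>x\<in>A. f x = Some p}"
    unfolding S_def by (rule set_formal_sum[OF assms(1)])
  have ge: "c \<le> snd p" if "p \<in># S" for p
    using that assms(2) S by (cases p) force
  obtain a where "f x0 = Some (a, c)"
    using assms(4) by (auto simp: val_def split: option.splits)
  then have "(a, c) \<in># S" using S assms(3) by auto
  then have "(\<forall>y \<in># S. snd p \<le> snd y) \<longleftrightarrow> snd p = c" if "p \<in># S" for p
    using ge that by (metis order_antisym snd_conv)
  then have "filter_mset (\<lambda>x. \<forall>y \<in># S. snd x \<le> snd y) S = filter_mset (\<lambda>p. snd p = c) S"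
    by (intro filter_mset_cong) auto
  also have "image_mset fst \<dots> = formal_sum (\<lambda>x. lead c (f x)) A"
  proof -
    let ?B = "{x \<in> A. f x \<noteq> None}"
    have "{x \<in> ?B. snd (the (f x)) = c} = {x \<in> A. lead c (f x) \<noteq> None}"
      by (auto simp: lead_eq_Some_iff)
    then have "filter_mset (\<lambda>p. snd p = c) S =
        image_mset (\<lambda>x. the (f x)) (mset_set {x \<in> A. lead c (f x) \<noteq> None})"
      using assms(1) by (simp add: S_def formal_sum_def filter_mset_image_mset del: not_None_eq)
    also have "image_mset fst \<dots> = formal_sum (\<lambda>x. lead c (f x)) A"
      unfolding formal_sum_def multiset.map_comp
      using assms(1) by (intro image_mset_cong) (auto simp: lead_eq_Some_iff)
    finally show ?thesis .
  qed
  finally show ?thesis .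
qed

text \<open>If no term has value \<open>c\<close>, the leading part is the zero sum; otherwise it is
  the sum that the null set of the extension tests.\<close>

lemma (in tract) lead_null:
  assumes "finite A" "\<And>x. x \<in> A \<Longrightarrow> Fin c \<le> val (f x)"
    and "formal_sum f A \<in> null (tropical_extension F)"
  shows "formal_sum (\<lambda>x. lead c (f x)) A \<in> null F"
proof (cases "\<exists>x\<in>A. val (f x) = Fin c")
  case True
  then obtain x where x: "x \<in> A" "val (f x) = Fin c" by blast
  then have "formal_sum f A \<noteq> {#}"
    using set_formal_sum[OF assms(1), of f] by (auto simp: val_def split: option.splits)
  then show ?thesis
    using assms(3) lead_part_formal_sum[of A c f, OF assms(1,2) x] by (simp add: tropical_extension_def)
next
  case False
  then have "lead c (f x) = None" if "x \<in> A" for x using that by (simp add: lead_eq_None_iff)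
  then show ?thesis by (simp add: formal_sum_None null_zero)
qed

text \<open>For this converse \<open>c\<close> has to be attained: otherwise the leading part is the
  zero sum and says nothing about \<open>f\<close>.\<close>

lemma lead_nullD:
  assumes "finite A" "\<And>x. x \<in> A \<Longrightarrow> Fin c \<le> val (f x)" "x0 \<in> A" "val (f x0) = Fin c"
    and "\<And>x. x \<in> A \<Longrightarrow> f x \<in> carrier0 (tropical_extension F)"
    and "formal_sum (\<lambda>x. lead c (f x)) A \<in> null F"
  shows "formal_sum f A \<in> null (tropical_extension F)"
proof -
  have "set_mset (formal_sum f A) \<subseteq> carrier (tropical_extension F)"
    using assms(5) by (force simp: set_formal_sum[OF assms(1)])
  then show ?thesis
    using assms(6) lead_part_formal_sum[of A c f, OF assms(1-4)] by (simp add: tropical_extension_def)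
qed

context tract
begin

lemma single_not_null: "a \<in> carrier F \<Longrightarrow> {#a#} \<notin> null F"
  using null_scale[of "{#a#}" "inv a"] one_not_null by auto

text \<open>If the second term had nonzero value, just one of the two terms would be of lowest
  value, but a single unit is never null.\<close>

lemma neg_one_tropical:
  "neg_one (tropical_extension F) = (neg_one F, 0 :: 'g::linordered_ab_group_add)"
  unfolding neg_one_def[of "tropical_extension F"]
proof (rule the_equality)
  show "(neg_one F, 0 :: 'g) \<in> carrier (tropical_extension F) \<and>
      {#\<one>\<^bsub>tropical_extension F\<^esub>, (neg_one F, 0)#} \<in> null (tropical_extension F)"
    using neg_one by (simp add: tropical_extension_def)
  fix e :: "'a \<times> 'g" assume e: "e \<in> carrier (tropical_extension F) \<and>
      {#\<one>\<^bsub>tropical_extension F\<^esub>, e#} \<in> null (tropical_extension F)"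
  obtain a \<gamma> where a: "e = (a, \<gamma>)" by fastforce
  then have aF: "a \<in> carrier F" using e by simp
  have "\<not> \<gamma> < 0" "\<not> 0 < \<gamma>"
    using e single_not_null[OF aF] one_not_null
    by (auto simp: a tropical_extension_def not_le split: if_splits)
  then have "\<gamma> = 0" by simp
  with e have "{#\<one>, a#} \<in> null F" by (simp add: a tropical_extension_def)
  then show "e = (neg_one F, 0)" using neg_one_unique[OF aF] a \<open>\<gamma> = 0\<close> by simp
qed

lemma sign0_tropical:
  "sign0 (tropical_extension F) s = Some (if s = 1 then \<one> else neg_one F, 0 :: 'g::linordered_ab_group_add)"
  by (simp add: sign0_def neg_one_tropical one_tropical)

lemma val_sign0_mult0 [simp]:
  "val (mult0 (tropical_extension F) (sign0 (tropical_extension F) s) x) = val x"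
  by (cases x) (auto simp: val_mult0 sign0_tropical)

lemma lead_sign0_mult0 [simp]:
  "lead c (mult0 (tropical_extension F) (sign0 (tropical_extension F) s) x) = mult0 F (sign0 F s) (lead c x)"
  by (cases x) (auto simp: sign0_tropical sign0_def[of F])

lemma tropical_mult0_closed [simp]:
  "x \<in> carrier0 (tropical_extension F) \<Longrightarrow> y \<in> carrier0 (tropical_extension F) \<Longrightarrow>
    mult0 (tropical_extension F) x y \<in> carrier0 (tropical_extension F)"
  by (auto simp: carrier0_def tropical_extension_def)

lemma tropical_sign0_closed [simp]: "sign0 (tropical_extension F) s \<in> carrier0 (tropical_extension F)"
  by (simp add: sign0_tropical neg_one)

end

text \<open>\<open>m\<close> is the minimum of \<open>val (P B) - sum u B\<close>; the sum is moved
  to the other side to avoid differences of extended values.\<close>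

definition level ::
    "'e set \<Rightarrow> nat \<Rightarrow> ('e set \<Rightarrow> ('a \<times> 'g::linordered_ab_group_add) option) \<Rightarrow> ('e \<Rightarrow> 'g) \<Rightarrow> 'g \<Rightarrow> bool" where
  "level E r P u m \<longleftrightarrow> (\<forall>B \<in> nsets E r. Fin (m + sum u B) \<le> val (P B)) \<and>
    (\<exists>B \<in> nsets E r. val (P B) = Fin (m + sum u B))"

lemma ex_level:
  fixes P :: "'e set \<Rightarrow> ('a \<times> 'g::linordered_ab_group_add) option"
  assumes "finite E" "\<exists>B \<in> nsets E r. P B \<noteq> None"
  shows "\<exists>m. level E r P u m"
proof -
  define N where "N = {B \<in> nsets E r. P B \<noteq> None}"
  define w where "w B = snd (the (P B)) - sum u B" for B
  have val: "val (P B) = Fin (w B + sum u B)" if "B \<in> N" for B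
    using that by (auto simp: N_def w_def)
  have fin: "finite (w ` N)" and ne: "w ` N \<noteq> {}"
    using assms finite_imp_finite_nsets[OF assms(1)] by (auto simp: N_def simp del: not_None_eq)
  then obtain B0 where B0: "B0 \<in> N" "w B0 = Min (w ` N)" using Min_in by (metis imageE)
  have "Fin (w B0 + sum u B) \<le> val (P B)" if "B \<in> nsets E r" for B
  proof (cases "B \<in> N")
    case True
    then show ?thesis using val B0 fin by simp
  next
    case False
    then have "P B = None" using that by (simp add: N_def del: not_None_eq)
    then show ?thesis by simp
  qed
  moreover have "B0 \<in> nsets E r" using B0 by (simp add: N_def)
  ultimately show ?thesis using val[OF B0(1)] unfolding level_def by blast
qed

text \<open>The condition in \<open>initial\<close> compares \<open>B\<close> with all sets.
  Comparing it with one set attaining the level is enough, and it forces \<open>P B\<close> down to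
  its lower bound.\<close>

lemma initial_eq_lead:
  fixes P :: "'e set \<Rightarrow> ('a \<times> 'g::linordered_ab_group_add) option"
  assumes "level E r P u m"
  shows "initial E r P u = (\<lambda>B \<in> nsets E r. lead (m + sum u B) (P B))"
proof -
  have shift: "Fin m \<le> val x - Fin c \<longleftrightarrow> Fin (m + c) \<le> val x" "val x - Fin c \<le> Fin m \<longleftrightarrow> val x \<le> Fin (m + c)"
    for x :: "('a \<times> 'g) option" and c
    by (cases x; auto simp: le_diff_eq diff_le_eq)+
  have "(\<forall>J \<in> nsets E r. val (P B) - Fin (sum u B) \<le> val (P J) - Fin (sum u J)) \<longleftrightarrow>
      val (P B) \<le> Fin (m + sum u B)" if "B \<in> nsets E r" for B
  proof
    obtain B0 where B0: "B0 \<in> nsets E r" "val (P B0) = Fin (m + sum u B0)"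
      using assms by (auto simp: level_def)
    assume "\<forall>J \<in> nsets E r. val (P B) - Fin (sum u B) \<le> val (P J) - Fin (sum u J)"
    then have "val (P B) - Fin (sum u B) \<le> val (P B0) - Fin (sum u B0)" using B0(1) by blast
    then show "val (P B) \<le> Fin (m + sum u B)" using B0(2) by (simp add: shift)
  next
    assume "val (P B) \<le> Fin (m + sum u B)"
    then have "val (P B) - Fin (sum u B) \<le> Fin m" by (simp add: shift)
    moreover have "Fin m \<le> val (P J) - Fin (sum u J)" if "J \<in> nsets E r" for J
      using assms that by (auto simp: level_def shift)
    ultimately show "\<forall>J \<in> nsets E r. val (P B) - Fin (sum u B) \<le> val (P J) - Fin (sum u J)"
      by (meson order_trans)
  qed
  moreover have "(if val (P B) \<le> Fin (m + sum u B) then theta (P B) else None) = lead (m + sum u B) (P B)"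
    if "B \<in> nsets E r" for B
    using assms that by (cases "P B") (auto simp: level_def theta_def dest: order_antisym)
  ultimately show ?thesis by (auto simp: initial_def restrict_def fun_eq_iff)
qed

text \<open>Moving \<open>j\<close> from \<open>J\<close> to \<open>I\<close> leaves the total
  weight \<open>sum u I + sum u J\<close> unchanged. Hence all terms of a relation share the lower
  bound \<open>c\<close>, and the part at this bound is the relation of the initial
  function.\<close>

lemma (in tract) plucker_vector_initial:
  fixes P :: "'e::linorder set \<Rightarrow> ('a \<times> 'g::linordered_ab_group_add) option"
  assumes E: "finite E" and P: "plucker_vector (tropical_extension F) E r P"
  shows "plucker_vector F E r (initial E r P u)"
proof -
  let ?T = "tropical_extension F :: ('a \<times> 'g) tract"
  have Pc: "P \<in> nsets E r \<rightarrow>\<^sub>E carrier0 ?T" and ne: "\<exists>B\<in>nsets E r. P B \<noteq> None"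
    using P by (auto simp: plucker_vector_def)
  obtain m where m: "level E r P u m" using ex_level[OF E ne] by blast
  have I: "initial E r P u B = lead (m + sum u B) (P B)" if "B \<in> nsets E r" for B
    using that by (simp add: initial_eq_lead[OF m])
  show ?thesis
    unfolding plucker_vector_def
  proof (intro conjI allI impI)
    show "initial E r P u \<in> nsets E r \<rightarrow>\<^sub>E carrier0 F"
      using PiE_mem[OF Pc] by (auto simp: initial_eq_lead[OF m])
    show "\<exists>B\<in>nsets E r. initial E r P u B \<noteq> None"
      using m I by (auto simp: level_def lead_eq_None_iff simp del: not_None_eq)
    fix I J assume IE: "I \<subseteq> E" "card I + 1 = r" and J: "J \<in> nsets E (r + 1)"
    define f where "f j = mult0 ?T (sign0 ?T (plucker_sign j I J))
        (mult0 ?T (P (insert j I)) (P (J - {j})))" for j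
    define c where "c = m + m + (sum u I + sum u J)"
    have fin: "finite I" "finite J" using IE J E finite_subset by (auto simp: nsets_def)
    have B: "insert j I \<in> nsets E r" "J - {j} \<in> nsets E r" if "j \<in> J - I" for j
      using that fin IE J by (auto simp: nsets_def)
    have c: "c = (m + sum u (insert j I)) + (m + sum u (J - {j}))" if "j \<in> J - I" for j
      using that fin by (simp add: c_def sum.remove[of J j] algebra_simps)
    have le: "Fin (m + sum u (insert j I)) \<le> val (P (insert j I))"
      "Fin (m + sum u (J - {j})) \<le> val (P (J - {j}))" if "j \<in> J - I" for j
      using m B[OF that] by (auto simp: level_def)
    have "formal_sum (\<lambda>j. lead c (f j)) (J - I) \<in> null F"
    proof (rule lead_null)
      show "formal_sum f (J - I) \<in> null ?T"
        using P IE J by (simp add: plucker_vector_def f_def[abs_def])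
      show "Fin c \<le> val (f j)" if "j \<in> J - I" for j
        using add_mono[OF le[OF that]] unfolding f_def val_sign0_mult0
        by (simp only: val_mult0 plus_extended.simps c[OF that])
    qed (use fin in simp)
    also have "formal_sum (\<lambda>j. lead c (f j)) (J - I) =
        formal_sum (\<lambda>j. mult0 F (sign0 F (plucker_sign j I J))
          (mult0 F (initial E r P u (insert j I)) (initial E r P u (J - {j})))) (J - I)"
    proof (rule formal_sum_cong)
      fix j assume j: "j \<in> J - I"
      show "lead c (f j) = mult0 F (sign0 F (plucker_sign j I J))
          (mult0 F (initial E r P u (insert j I)) (initial E r P u (J - {j})))"
        using lead_mult0[OF le[OF j], of F] I[OF B(1)[OF j]] I[OF B(2)[OF j]]
        by (simp add: f_def c[OF j])
    qed
    finally show "formal_sum (\<lambda>j. mult0 F (sign0 F (plucker_sign j I J))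
          (mult0 F (initial E r P u (insert j I)) (initial E r P u (J - {j})))) (J - I) \<in> null F" .
  qed
qed

section \<open>Deletion and contraction\<close>

text \<open>
  Deletion and contraction keep the ground set and the rank: \<open>x\<close> becomes a loop and a coloop,
  respectively. Hence \<open>del\<close> is the deletion only if \<open>x\<close> is not a coloop.
\<close>

definition del :: "'e set \<Rightarrow> nat \<Rightarrow> 'e \<Rightarrow> ('e set \<Rightarrow> 'a option) \<Rightarrow> 'e set \<Rightarrow> 'a option" where
  "del E r x P = (\<lambda>B \<in> nsets E r. if x \<in> B then None else P B)"

definition con :: "'e set \<Rightarrow> nat \<Rightarrow> 'e \<Rightarrow> ('e set \<Rightarrow> 'a option) \<Rightarrow> 'e set \<Rightarrow> 'a option" where
  "con E r x P = (\<lambda>B \<in> nsets E r. if x \<in> B then P B else None)"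

lemma circ_del:
  assumes "J \<in> nsets E (r + 1)"
  shows "circ F (del E r x P) J j = (if x \<in> J \<and> j \<noteq> x then None else circ F P J j)"
proof (cases "j \<in> J")
  case True
  then have "J - {j} \<in> nsets E r" using assms by (auto simp: nsets_def)
  then show ?thesis using True by (auto simp: circ_def del_def)
qed (simp add: circ_def)

lemma insert_nsets:
  "finite E \<Longrightarrow> I \<subseteq> E \<Longrightarrow> card I + 1 = r \<Longrightarrow> j \<in> E \<Longrightarrow> j \<notin> I \<Longrightarrow> insert j I \<in> nsets E r"
  using finite_subset by (auto simp: nsets_def)

lemma cocirc_del:
  assumes "finite E" "I \<subseteq> E" "card I + 1 = r" "j \<in> E"
  shows "cocirc F (del E r x P) I j = (if x \<in> I \<or> j = x then None else cocirc F P I j)"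
  using insert_nsets[OF assms] by (auto simp: cocirc_def del_def)

lemma cocirc_con:
  assumes "finite E" "I \<subseteq> E" "card I + 1 = r" "j \<in> E"
  shows "cocirc F (con E r x P) I j = (if x \<in> I \<or> j = x then cocirc F P I j else None)"
  using insert_nsets[OF assms] by (auto simp: cocirc_def con_def)

lemma pairing_None: "(\<And>i. i \<in> E \<Longrightarrow> X i = None \<or> Y i = None) \<Longrightarrow> pairing F E X Y = {#}"
  unfolding pairing_def by (rule formal_sum_None) auto

text \<open>If \<open>x\<close> is in \<open>I\<close>, the cocircuit is zero; if \<open>x\<close>
  is in \<open>J\<close>, the circuit lives on \<open>x\<close> alone, where the cocircuit vanishes.
  Otherwise the relation is one of \<open>P\<close>. Nonvanishing is assumed because all bases may
  contain \<open>x\<close>.\<close>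

lemma (in tract) plucker_vector_del:
  assumes E: "finite E" and P: "plucker_vector F E r P" and ne: "\<exists>B\<in>nsets E r. del E r x P B \<noteq> None"
  shows "plucker_vector F E r (del E r x P)"
  unfolding plucker_vector_iff[OF E]
proof (intro conjI allI impI)
  have Pc: "P \<in> nsets E r \<rightarrow>\<^sub>E carrier0 F"
    and rel: "\<And>I J. I \<subseteq> E \<Longrightarrow> card I + 1 = r \<Longrightarrow> J \<in> nsets E (r + 1) \<Longrightarrow>
      pairing F E (circ F P J) (cocirc F P I) \<in> null F"
    using P E by (auto simp: plucker_vector_iff)
  show "del E r x P \<in> nsets E r \<rightarrow>\<^sub>E carrier0 F"
    using PiE_mem[OF Pc] by (auto simp: del_def)
  show "\<exists>B\<in>nsets E r. del E r x P B \<noteq> None" by (rule ne)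
  fix I J assume I: "I \<subseteq> E" "card I + 1 = r" and J: "J \<in> nsets E (r + 1)"
  note c = circ_del[OF J, of F x P] cocirc_del[OF E I, of _ F x P]
  show "pairing F E (circ F (del E r x P) J) (cocirc F (del E r x P) I) \<in> null F"
  proof (cases "x \<in> I \<or> x \<in> J")
    case True
    then have "pairing F E (circ F (del E r x P) J) (cocirc F (del E r x P) I) = {#}"
      by (intro pairing_None) (auto simp: c)
    then show ?thesis by (simp add: null_zero)
  next
    case False
    moreover from this have "circ F P J x = None" by (simp add: circ_def)
    ultimately have "pairing F E (circ F (del E r x P) J) (cocirc F (del E r x P) I) =
        pairing F E (circ F P J) (cocirc F P I)"
      by (intro pairing_cong) (auto simp: c)
    then show ?thesis using rel[OF I J] by simp
  qed
qed

text \<open>If \<open>x\<close> is not in \<open>I\<close>, the two cocircuits differ only at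
  \<open>x\<close>, where \<open>X\<close> is zero. If \<open>x\<close> is in \<open>I\<close>, the
  cocircuit of the deletion is zero and gives no information, but the one of \<open>P\<close> is a
  covector of the deletion, so perfection applies.\<close>

lemma (in perfect_tract) pairing_cocirc_of_del:
  assumes E: "finite E" and P: "plucker_vector F E r P" and Pd: "plucker_vector F E r (del E r x P)"
    and X: "\<And>i. i \<in> E \<Longrightarrow> X i \<in> carrier0 F" "X x = None"
    and XI: "\<And>I. I \<subseteq> E \<Longrightarrow> card I + 1 = r \<Longrightarrow> pairing F E X (cocirc F (del E r x P) I) \<in> null F"
    and I: "I \<subseteq> E" "card I + 1 = r"
  shows "pairing F E X (cocirc F P I) \<in> null F"
proof (cases "x \<in> I")
  case False
  then have "pairing F E X (cocirc F (del E r x P) I) = pairing F E X (cocirc F P I)"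
    using X(2) by (intro pairing_cong) (auto simp: cocirc_del[OF E I])
  then show ?thesis using XI[OF I] by simp
next
  case True
  have Pc: "P \<in> nsets E r \<rightarrow>\<^sub>E carrier0 F"
    and rel: "\<And>J. J \<in> nsets E (r + 1) \<Longrightarrow> pairing F E (circ F P J) (cocirc F P I) \<in> null F"
    using P E I by (auto simp: plucker_vector_iff)
  show ?thesis
  proof (rule vector_covector_pairing[OF E Pd X(1) _ XI])
    show "cocirc F P I i \<in> carrier0 F" if "i \<in> E" for i
      by (rule cocirc_closed[OF E Pc I that])
    fix J assume J: "J \<in> nsets E (r + 1)"
    show "pairing F E (circ F (del E r x P) J) (cocirc F P I) \<in> null F"
    proof (cases "x \<in> J")
      case True
      then have "pairing F E (circ F (del E r x P) J) (cocirc F P I) = {#}"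
        using \<open>x \<in> I\<close> by (intro pairing_None) (auto simp: circ_del[OF J] cocirc_def)
      then show ?thesis by (simp add: null_zero)
    next
      case False
      then have "pairing F E (circ F (del E r x P) J) (cocirc F P I) =
          pairing F E (circ F P J) (cocirc F P I)"
        by (intro pairing_cong) (simp add: circ_del[OF J])
      then show ?thesis using rel[OF J] by simp
    qed
  qed auto
qed

text \<open>Contraction keeps the cocircuits with \<open>x\<close> in \<open>I\<close>; the others
  shrink to the coordinate \<open>x\<close>, where \<open>X\<close> is zero.\<close>

lemma (in tract) pairing_cocirc_con:
  assumes E: "finite E" and X: "X x = None" and I: "I \<subseteq> E" "card I + 1 = r"
    and XI: "pairing F E X (cocirc F P I) \<in> null F"
  shows "pairing F E X (cocirc F (con E r x P) I) \<in> null F"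
proof (cases "x \<in> I")
  case True
  then have "pairing F E X (cocirc F (con E r x P) I) = pairing F E X (cocirc F P I)"
    by (intro pairing_cong) (simp add: cocirc_con[OF E I])
  then show ?thesis using XI by simp
next
  case False
  then have "pairing F E X (cocirc F (con E r x P) I) = {#}"
    using X by (intro pairing_None) (auto simp: cocirc_con[OF E I])
  then show ?thesis by (simp add: null_zero)
qed

text \<open>\<open>m\<close> and \<open>m'\<close> are the levels of the bases avoiding and
  containing \<open>x\<close>. Adding \<open>m' - m\<close> to \<open>u x\<close> brings the second
  to \<open>m\<close> and leaves the first alone, so both kinds of bases occur at \<open>u'\<close>.
  At \<open>u\<close> itself the smaller level decides which kind survives.\<close>

lemma level_shift:
  fixes P :: "'e set \<Rightarrow> ('a \<times> 'g::linordered_ab_group_add) option"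
  assumes E: "finite E" and B: "level E r (del E r x P) u m" and A: "level E r (con E r x P) u m'"
  defines "u' \<equiv> u(x := u x + (m' - m))"
  shows "level E r P u' m"
    and "initial E r (del E r x P) u = del E r x (initial E r P u')"
    and "m < m' \<Longrightarrow> initial E r P u = del E r x (initial E r P u')"
    and "m' < m \<Longrightarrow> initial E r P u = con E r x (initial E r P u')"
proof -
  have sum: "sum u' S = sum u S + (if x \<in> S then m' - m else 0)" if "S \<in> nsets E r" for S
  proof -
    have "finite S" using that by (auto simp: nsets_def)
    then show ?thesis
      by (cases "x \<in> S") (auto simp: u'_def sum.remove[of S x] algebra_simps intro!: sum.cong)
  qed
  have A': "Fin (m' + sum u S) \<le> val (P S)" if "S \<in> nsets E r" "x \<in> S" for S
    using A that by (auto simp: level_def con_def)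
  have B': "Fin (m + sum u S) \<le> val (P S)" if "S \<in> nsets E r" "x \<notin> S" for S
    using B that by (auto simp: level_def del_def)
  obtain S where S: "S \<in> nsets E r" "x \<notin> S" "val (P S) = Fin (m + sum u S)"
    using B by (auto simp: level_def del_def split: if_splits)
  obtain R where R: "R \<in> nsets E r" "x \<in> R" "val (P R) = Fin (m' + sum u R)"
    using A by (auto simp: level_def con_def split: if_splits)
  have eq: "m + sum u' S = (if x \<in> S then m' else m) + sum u S" if "S \<in> nsets E r" for S
    using sum[OF that] by (simp add: algebra_simps)
  show L: "level E r P u' m"
    unfolding level_def
  proof (intro conjI ballI)
    show "\<exists>S\<in>nsets E r. val (P S) = Fin (m + sum u' S)" using S eq by auto
    show "Fin (m + sum u' S) \<le> val (P S)" if "S \<in> nsets E r" for S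
      using A' B' that by (simp add: eq)
  qed
  note init = initial_eq_lead[OF L]
  show "initial E r (del E r x P) u = del E r x (initial E r P u')"
    unfolding initial_eq_lead[OF B] init by (auto simp: del_def eq fun_eq_iff)
  show "initial E r P u = del E r x (initial E r P u')" if less: "m < m'"
  proof -
    have "Fin (m + sum u T) < val (P T)" if "T \<in> nsets E r" "x \<in> T" for T
    proof -
      have "Fin (m + sum u T) < Fin (m' + sum u T)" using less by simp
      then show ?thesis using A'[OF that] by (rule less_le_trans)
    qed
    then have "level E r P u m" "\<And>T. T \<in> nsets E r \<Longrightarrow> x \<in> T \<Longrightarrow> lead (m + sum u T) (P T) = None"
      using B' S unfolding level_def by (auto intro: lead_eq_None less_imp_le)
    then show ?thesis
      unfolding init by (subst initial_eq_lead) (auto simp: del_def eq fun_eq_iff)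
  qed
  show "initial E r P u = con E r x (initial E r P u')" if less: "m' < m"
  proof -
    have "Fin (m' + sum u T) < val (P T)" if "T \<in> nsets E r" "x \<notin> T" for T
    proof -
      have "Fin (m' + sum u T) < Fin (m + sum u T)" using less by simp
      then show ?thesis using B'[OF that] by (rule less_le_trans)
    qed
    then have "level E r P u m'" "\<And>T. T \<in> nsets E r \<Longrightarrow> x \<notin> T \<Longrightarrow> lead (m' + sum u T) (P T) = None"
      using A' R unfolding level_def by (auto intro: lead_eq_None less_imp_le)
    then show ?thesis
      unfolding init by (subst initial_eq_lead) (auto simp: con_def eq fun_eq_iff)
  qed
qed

text \<open>The part of the circuit of \<open>J\<close> whose entries have value \<open>n\<close>
  after adding \<open>u j\<close>. Circuits are shifted by \<open>+ u j\<close> although bases are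
  shifted by \<open>- sum u B\<close>, because \<open>J - {j}\<close> is the set missing
  \<open>j\<close>.\<close>

definition lead_circ :: "'a tract \<Rightarrow> ('e::linorder \<Rightarrow> 'g::linordered_ab_group_add) \<Rightarrow> 'g \<Rightarrow>
    ('e set \<Rightarrow> ('a \<times> 'g) option) \<Rightarrow> 'e set \<Rightarrow> 'e \<Rightarrow> 'a option" where
  "lead_circ F u n P J j = (if j \<in> J
    then mult0 F (sign0 F ((-1) ^ card {i \<in> J. i < j})) (lead (n - u j) (P (J - {j}))) else None)"

text \<open>\<open>S\<close> bounds the elements that bases use outside \<open>J\<close>. The
  induction generalises \<open>P\<close> because it passes to deletions, and \<open>H\<close> speaks
  of every weight because the step changes \<open>u\<close>.\<close>

lemma (in perfect_tract) pairing_lead_circ: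
  fixes P :: "'e::linorder set \<Rightarrow> ('a \<times> 'g::linordered_ab_group_add) option"
  assumes E: "finite E" and J: "J \<in> nsets E (r + 1)" and S: "finite S" "S \<inter> J = {}"
    and Pc: "P \<in> nsets E r \<rightarrow>\<^sub>E carrier0 (tropical_extension F)"
    and H: "\<And>v. plucker_vector F E r (initial E r P v)"
    and supp: "\<And>B. B \<in> nsets E r \<Longrightarrow> P B \<noteq> None \<Longrightarrow> B \<subseteq> J \<union> S"
    and lb: "\<And>j. j \<in> J \<Longrightarrow> Fin (n - u j) \<le> val (P (J - {j}))"
    and att: "\<exists>j\<in>J. val (P (J - {j})) = Fin (n - u j)"
    and I: "I \<subseteq> E" "card I + 1 = r"
  shows "pairing F E (lead_circ F u n P J) (cocirc F (initial E r P u) I) \<in> null F"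
  using S Pc H supp lb att I
proof (induction S arbitrary: P I rule: finite_induct)
  case empty
  have J_diff: "J - {j} \<in> nsets E r" if "j \<in> J" for j
    using J that by (auto simp: nsets_def)
  have fin: "finite J" using J by (simp add: nsets_def)
  have sum: "n - sum u J + sum u (J - {j}) = n - u j" if "j \<in> J" for j
    using that fin by (simp add: sum.remove[of J j] algebra_simps)
  \<comment> \<open>Every basis now has the form \<open>J - {j}\<close>, so the bounds on the
    circuit entries bound all bases.\<close>
  have L: "level E r P u (n - sum u J)"
    unfolding level_def
  proof (intro conjI ballI)
    show "\<exists>B\<in>nsets E r. val (P B) = Fin (n - sum u J + sum u B)"
      using empty.prems(6) J_diff sum by metis
    fix B assume B: "B \<in> nsets E r"
    show "Fin (n - sum u J + sum u B) \<le> val (P B)"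
    proof (cases "P B")
      case (Some p)
      then have "B \<subseteq> J" using empty.prems(4)[OF B] by auto
      moreover have "card J = card B + 1" using B J by (auto simp: nsets_def)
      ultimately have "card (J - B) = 1"
        using B by (auto simp: nsets_def card_Diff_subset)
      then obtain j where "J - B = {j}" by (rule card_1_singletonE)
      then have "B = J - {j}" "j \<in> J" using \<open>B \<subseteq> J\<close> by auto
      then show ?thesis using empty.prems(5)[of j] by (simp only: sum)
    qed simp
  qed
  have "initial E r P u (J - {j}) = lead (n - u j) (P (J - {j}))" if "j \<in> J" for j
    unfolding initial_eq_lead[OF L] using J_diff[OF that] by (simp only: restrict_apply' sum[OF that])
  then have "lead_circ F u n P J j = circ F (initial E r P u) J j" for j
    by (simp add: lead_circ_def circ_def)
  then have "lead_circ F u n P J = circ F (initial E r P u) J" by blast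
  then show ?case
    using empty.prems(3)[of u] E J empty.prems(7,8) by (simp add: plucker_vector_iff)
next
  case (insert x S)
  let ?Pd = "del E r x P" and ?Pc = "con E r x P"
  have xJ: "x \<notin> J" using insert.prems(1) by auto
  have SJ: "S \<inter> J = {}" using insert.prems(1) by auto
  show ?case
  proof (cases "\<exists>B\<in>nsets E r. ?Pc B \<noteq> None")
    case False
    have "B \<subseteq> J \<union> S" if "B \<in> nsets E r" "P B \<noteq> None" for B
    proof -
      have "x \<notin> B" using False that by (auto simp: con_def simp del: not_None_eq)
      then show ?thesis using insert.prems(4)[OF that] by auto
    qed
    then show ?thesis
      by (rule insert.IH[OF SJ insert.prems(2,3) _ insert.prems(5-8)])
  next
    case True
    have Jd: "J - {j} \<in> nsets E r" "?Pd (J - {j}) = P (J - {j})" if "j \<in> J" for j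
      using that J xJ by (auto simp: nsets_def del_def)
    \<comment> \<open>The entry that attains \<open>n\<close> belongs to a basis inside
      \<open>J\<close>, hence to one avoiding \<open>x\<close>.\<close>
    have ne: "\<exists>B\<in>nsets E r. ?Pd B \<noteq> None"
    proof -
      obtain j where "j \<in> J" "val (P (J - {j})) = Fin (n - u j)" using insert.prems(6) by blast
      then show ?thesis using Jd[of j] by (cases "P (J - {j})") (auto intro!: bexI[of _ "J - {j}"])
    qed
    \<comment> \<open>The hypothesis on all weights passes to the deletion, whose initial function
      at \<open>v\<close> is the deletion of an initial function of \<open>P\<close> at a shifted
      weight.\<close>
    have Pd: "plucker_vector F E r (initial E r ?Pd v)" for v
    proof -
      obtain m where m: "level E r ?Pd v m" using ex_level[OF E ne] by blast
      obtain m' where m': "level E r ?Pc v m'" using ex_level[OF E True] by blast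
      have B: "\<exists>B\<in>nsets E r. initial E r ?Pd v B \<noteq> None"
        using m by (auto simp: initial_eq_lead[OF m] level_def lead_eq_None_iff simp del: not_None_eq)
      show ?thesis
        using B plucker_vector_del[OF E insert.prems(3)] by (simp add: level_shift(2)[OF E m m'])
    qed
    have X: "lead_circ F u n ?Pd J = lead_circ F u n P J"
      using Jd by (auto simp: lead_circ_def fun_eq_iff)
    have dI: "pairing F E (lead_circ F u n P J) (cocirc F (initial E r ?Pd u) I) \<in> null F"
      if I: "I \<subseteq> E" "card I + 1 = r" for I
      unfolding X[symmetric]
    proof (rule insert.IH[OF SJ _ Pd _ _ _ I])
      show "?Pd \<in> nsets E r \<rightarrow>\<^sub>E carrier0 (tropical_extension F)"
        using PiE_mem[OF insert.prems(2)] by (auto simp: del_def)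
      show "B \<subseteq> J \<union> S" if "B \<in> nsets E r" "?Pd B \<noteq> None" for B
        using that insert.prems(4)[of B] by (auto simp: del_def split: if_splits)
    qed (use insert.prems(5,6) Jd in auto)
    obtain m where m: "level E r ?Pd u m" using ex_level[OF E ne] by blast
    obtain m' where m': "level E r ?Pc u m'" using ex_level[OF E True] by blast
    define u' where "u' = u(x := u x + (m' - m))"
    note shift = level_shift[OF E m m', folded u'_def]
    have Xx: "lead_circ F u n P J x = None" using xJ by (simp add: lead_circ_def)
    have Xc: "lead_circ F u n P J i \<in> carrier0 F" for i
      using Jd(1)[of i] PiE_mem[OF insert.prems(2)] by (auto simp: lead_circ_def)
    \<comment> \<open>Perfection enters here and lifts orthogonality from the deletion to the
      initial function at \<open>u'\<close>.\<close>
    have cI: "pairing F E (lead_circ F u n P J) (cocirc F (initial E r P u') I) \<in> null F"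
    proof (rule pairing_cocirc_of_del[where x = x, OF E])
      show "plucker_vector F E r (del E r x (initial E r P u'))" using Pd[of u] by (simp only: shift(2))
      show "pairing F E (lead_circ F u n P J) (cocirc F (del E r x (initial E r P u')) I) \<in> null F"
        if "I \<subseteq> E" "card I + 1 = r" for I
        using dI[OF that] by (simp only: shift(2))
    qed (use insert.prems(3,7,8) Xc Xx in auto)
    \<comment> \<open>The initial function at \<open>u\<close> is the deletion settled by
      \<open>dI\<close>, a contraction of the one in \<open>cI\<close>, or the one in
      \<open>cI\<close> itself.\<close>
    consider "m < m'" | "m' < m" | "m = m'" by fastforce
    then show ?thesis
    proof cases
      case 1
      then show ?thesis using dI[OF insert.prems(7,8)] shift(2,3) by simp
    next
      case 2
      then show ?thesis
        using pairing_cocirc_con[OF E Xx insert.prems(7,8) cI] shift(4) by simp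
    next
      case 3
      then have "u' = u" by (simp add: u'_def)
      then show ?thesis using cI by simp
    qed
  qed
qed

section \<open>The Plucker relations of the tropical extension\<close>

lemma ex_upper_bound:
  fixes A :: "'g::linorder set"
  assumes "finite A"
  shows "\<exists>l. \<forall>a\<in>A. a \<le> l"
  using assms by (cases "A = {}") (auto intro: exI[of _ "Max A"])

text \<open>
  The weight is large on \<open>I\<close>, so that no basis missing a part of \<open>I\<close> lies below the level of the bases
  containing \<open>I\<close>. All bounds are weak, so that the trivial group needs no special treatment.
\<close>

lemma ex_cocircuit_weight:
  fixes P :: "'e set \<Rightarrow> ('a \<times> 'g::linordered_ab_group_add) option"
  assumes E: "finite E" and I: "I \<subseteq> E" "card I + 1 = r"
    and ne: "\<exists>j\<in>E - I. P (insert j I) \<noteq> None"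
  shows "\<exists>u. level E r P u (- sum u I) \<and>
    (\<forall>j\<in>E - I. P (insert j I) \<noteq> None \<longrightarrow> val (P (insert j I)) = Fin (u j)) \<and>
    (\<forall>j\<in>E. j \<in> I \<or> P (insert j I) = None \<longrightarrow> b j \<le> u j)"
proof -
  have fin: "finite I" using I E finite_subset by blast
  obtain l where l: "\<forall>a\<in>b ` E. a \<le> l" using ex_upper_bound[of "b ` E"] E by auto
  \<comment> \<open>The value of the cocircuit on its support, and elsewhere the common bound
    \<open>l\<close> of all \<open>b j\<close>.\<close>
  define u0 where "u0 j = (case P (insert j I) of None \<Rightarrow> l | Some p \<Rightarrow> snd p)" for j
  \<comment> \<open>The amount that \<open>L\<close> has to reach for \<open>B\<close> to stay above
    the level when one element of \<open>I\<close> is missing. Further missing elements only help,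
    since \<open>L\<close> is nonnegative.\<close>
  define gap where "gap B = sum u0 (B - I) - (case P B of None \<Rightarrow> 0 | Some p \<Rightarrow> snd p)" for B
  have "finite (insert 0 (insert l (gap ` nsets E r)))"
    using finite_imp_finite_nsets[OF E] by simp
  from ex_upper_bound[OF this]
  obtain L where L: "\<forall>a\<in>insert 0 (insert l (gap ` nsets E r)). a \<le> L" ..
  define u where "u j = (if j \<in> I then L else u0 j)" for j
  have uI: "val (P (insert j I)) = Fin (u j)" if "j \<in> E - I" "P (insert j I) \<noteq> None" for j
    using that by (auto simp: u_def u0_def)
  have ins: "- sum u I + sum u (insert j I) = u j" if "j \<notin> I" for j
    using that fin by simp
  have "level E r P u (- sum u I)"
    unfolding level_def
  proof (intro conjI ballI)
    obtain j where j: "j \<in> E - I" "P (insert j I) \<noteq> None" using ne by (rule bexE)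
    show "\<exists>B\<in>nsets E r. val (P B) = Fin (- sum u I + sum u B)"
    proof
      show "insert j I \<in> nsets E r" using insert_nsets[OF E I] j(1) by simp
      show "val (P (insert j I)) = Fin (- sum u I + sum u (insert j I))"
        using uI[OF j] ins[of j] j(1) by simp
    qed
    fix B assume B: "B \<in> nsets E r"
    have fB: "finite B" "card B = card I + 1" using B I by (auto simp: nsets_def)
    show "Fin (- sum u I + sum u B) \<le> val (P B)"
    proof (cases "P B")
      case (Some p)
      show ?thesis
      proof (cases "I \<subseteq> B")
        case True
        then have "card (B - I) = 1" using fB fin by (simp add: card_Diff_subset)
        then obtain j where "B - I = {j}" by (rule card_1_singletonE)
        then have j: "B = insert j I" "j \<notin> I" using True by auto
        then have "j \<in> E - I" using B by (auto simp: nsets_def)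
        then show ?thesis using uI[of j] Some j ins[of j] by simp
      next
        case False
        then obtain i where i: "i \<in> I - B" by blast
        have L0: "0 \<le> L" "gap B \<le> L" using L B by auto
        have "sum u I = sum u (I \<inter> B) + sum u (I - B)" "sum u B = sum u (I \<inter> B) + sum u (B - I)"
          using fin fB by (metis sum.Int_Diff, metis sum.Int_Diff inf_commute)
        then have "- sum u I + sum u B = sum u (B - I) - sum u (I - B)" by simp
        also have "sum u (B - I) = sum u0 (B - I)"
          by (rule sum.cong) (auto simp: u_def)
        finally have eq: "- sum u I + sum u B = sum u0 (B - I) - sum u (I - B)" .
        have "L \<le> sum u (I - B)"
        proof -
          have "sum u (I - B) = u i + sum u (I - B - {i})"
            using i fin by (simp add: sum.remove)
          moreover have "0 \<le> sum u (I - B - {i})"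
            by (rule sum_nonneg) (use L0 in \<open>auto simp: u_def\<close>)
          ultimately show ?thesis using i by (simp add: u_def)
        qed
        then have "- sum u I + sum u B \<le> sum u0 (B - I) - L" unfolding eq by (rule diff_left_mono)
        also have "\<dots> \<le> snd p" using L0(2) Some by (simp add: gap_def algebra_simps)
        finally show ?thesis using Some by (cases p) simp
      qed
    qed simp
  qed
  moreover have "b j \<le> u j" if "j \<in> E" "j \<in> I \<or> P (insert j I) = None" for j
  proof -
    have "b j \<le> l" "l \<le> L" using that l L by auto
    then show ?thesis using that by (auto simp: u_def u0_def)
  qed
  ultimately show ?thesis using uI by blast
qed

text \<open>Only the lowest terms of a Plucker relation of \<open>P\<close> matter. The weight is
  chosen so that, up to a common sign, they are the terms of the pairing in
  \<open>pairing_lead_circ\<close>.\<close>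

lemma (in perfect_tract) plucker_vector_of_initial:
  fixes P :: "'e::linorder set \<Rightarrow> ('a \<times> 'g::linordered_ab_group_add) option"
  assumes E: "finite E" and Pc: "P \<in> nsets E r \<rightarrow>\<^sub>E carrier0 (tropical_extension F)"
    and H: "\<And>u. plucker_vector F E r (initial E r P u)"
  shows "plucker_vector (tropical_extension F) E r P"
  unfolding plucker_vector_def
proof (intro conjI allI impI)
  let ?T = "tropical_extension F :: ('a \<times> 'g) tract"
  show "P \<in> nsets E r \<rightarrow>\<^sub>E carrier0 ?T" by (rule Pc)
  show "\<exists>I\<in>nsets E r. P I \<noteq> None"
  proof -
    obtain B where "B \<in> nsets E r" "initial E r P (\<lambda>_. 0) B \<noteq> None"
      using H[of "\<lambda>_. 0"] unfolding plucker_vector_def by blast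
    then show ?thesis by (auto simp: initial_def theta_def split: if_splits)
  qed
  fix I J assume I: "I \<subseteq> E" "card I + 1 = r" and J: "J \<in> nsets E (r + 1)"
  have fin: "finite I" "finite J" using I J E finite_subset by (auto simp: nsets_def)
  have JE: "J \<subseteq> E" using J by (auto simp: nsets_def)
  have B: "J - {j} \<in> nsets E r" if "j \<in> J" for j
    using that J by (auto simp: nsets_def)
  have B': "insert j I \<in> nsets E r" if "j \<in> J - I" for j
    using insert_nsets[OF E I] that JE by auto
  define f where "f j = mult0 ?T (sign0 ?T (plucker_sign j I J))
      (mult0 ?T (P (insert j I)) (P (J - {j})))" for j
  have vf: "val (f j) = val (P (insert j I)) + val (P (J - {j}))" for j
    unfolding f_def val_sign0_mult0 by (rule val_mult0)
  have fc: "f j \<in> carrier0 ?T" if "j \<in> J - I" for j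
    unfolding f_def using PiE_mem[OF Pc] B B' that by simp
  have "formal_sum f (J - I) \<in> null ?T"
  proof (cases "\<exists>j\<in>J - I. f j \<noteq> None")
    case False
    then have "formal_sum f (J - I) = {#}" by (intro formal_sum_None) blast
    then show ?thesis by (simp add: tropical_extension_def)
  next
    case True
    define w where "w j = snd (the (f j))" for j
    define N where "N = {j \<in> J - I. f j \<noteq> None}"
    have "finite (w ` N)" "w ` N \<noteq> {}" using True fin by (auto simp: N_def simp del: not_None_eq)
    then obtain j0 where j0: "j0 \<in> N" "w j0 = Min (w ` N)" using Min_in by (metis imageE)
    define c where "c = w j0"
    have valw: "val (f j) = Fin (w j)" if "j \<in> N" for j using that by (auto simp: N_def w_def)
    have le: "Fin c \<le> val (f j)" if "j \<in> J - I" for j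
    proof (cases "f j")
      case (Some p)
      then have "j \<in> N" using that by (simp add: N_def)
      then show ?thesis using valw j0 \<open>finite (w ` N)\<close> by (simp add: c_def)
    qed simp
    have j0': "j0 \<in> J - I" "val (f j0) = Fin c" using j0 valw by (auto simp: N_def c_def)
    then have fin0: "P (insert j0 I) \<noteq> None" "P (J - {j0}) \<noteq> None"
      using vf[of j0] by (auto simp: val_def plus_case split: option.splits extended.splits)
    \<comment> \<open>The least weight at \<open>j\<close> that lifts the circuit entry to value
      \<open>c\<close>. A zero entry demands nothing, so its default \<open>0\<close> is
      arbitrary.\<close>
    define b where "b j = (case P (J - {j}) of None \<Rightarrow> 0 | Some p \<Rightarrow> c - snd p)" for j
    obtain u where lev: "level E r P u (- sum u I)"
      and uD: "\<And>j. j \<in> E - I \<Longrightarrow> P (insert j I) \<noteq> None \<Longrightarrow> val (P (insert j I)) = Fin (u j)"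
      and ub: "\<And>j. j \<in> E \<Longrightarrow> j \<in> I \<or> P (insert j I) = None \<Longrightarrow> b j \<le> u j"
      using ex_cocircuit_weight[OF E I, of P b] j0' fin0 JE by blast
    have val_add: "val x = Fin a \<Longrightarrow> Fin c \<le> val x + val y \<longleftrightarrow> Fin (c - a) \<le> val y"
      "val x = Fin a \<Longrightarrow> val x + val y = Fin c \<longleftrightarrow> val y = Fin (c - a)"
      for x y :: "('a \<times> 'g) option" and a
      by (cases y; auto simp: algebra_simps)+
    \<comment> \<open>On the support of the cocircuit this restates that all terms of the relation
      have value at least \<open>c\<close>; elsewhere it is what \<open>b\<close> was chosen
      for.\<close>
    have lb: "Fin (c - u j) \<le> val (P (J - {j}))" if "j \<in> J" for j
    proof (cases "j \<in> I \<or> P (insert j I) = None")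
      case True
      then have "b j \<le> u j" using ub that JE by blast
      then show ?thesis by (cases "P (J - {j})") (auto simp: b_def algebra_simps)
    next
      case False
      then have v: "val (P (insert j I)) = Fin (u j)" and "j \<in> J - I"
        using uD[of j] that JE by auto
      then have "Fin c \<le> val (P (insert j I)) + val (P (J - {j}))"
        using le[of j] by (simp only: vf)
      then show ?thesis using val_add(1)[OF v] by simp
    qed
    have att: "val (P (J - {j0})) = Fin (c - u j0)"
    proof -
      have v: "val (P (insert j0 I)) = Fin (u j0)" using j0' uD[of j0] fin0 JE by auto
      have "val (P (insert j0 I)) + val (P (J - {j0})) = Fin c" using j0'(2) by (simp only: vf)
      then show ?thesis using val_add(2)[OF v] by simp
    qed
    have ge: "Fin (u j) \<le> val (P (insert j I))" if "j \<in> J - I" for j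
      using uD[of j] that JE by (cases "P (insert j I)") auto
    have init: "initial E r P u (insert j I) = lead (u j) (P (insert j I))" if "j \<in> J - I" for j
      using that B' fin by (simp add: initial_eq_lead[OF lev])
    have "pairing F E (lead_circ F u c P J) (cocirc F (initial E r P u) I) \<in> null F"
    \<comment> \<open>With \<open>S\<close> equal to \<open>E - J\<close> the support condition
      holds for every basis.\<close>
    proof (rule pairing_lead_circ[OF E J, of "E - J"])
      show "\<exists>j\<in>J. val (P (J - {j})) = Fin (c - u j)" using att j0' by blast
      show "B \<subseteq> J \<union> (E - J)" if "B \<in> nsets E r" for B using that by (auto simp: nsets_def)
    qed (use E Pc H lb I in auto)
    also have "pairing F E (lead_circ F u c P J) (cocirc F (initial E r P u) I) =
        formal_sum (\<lambda>j. mult0 F (lead_circ F u c P J j) (cocirc F (initial E r P u) I j)) (J - I)"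
      unfolding pairing_def using E JE
      by (intro formal_sum_mono_neutral[symmetric]) (auto simp: lead_circ_def cocirc_def)
    also have "\<dots> \<in> null F \<longleftrightarrow> formal_sum (\<lambda>j. lead c (f j)) (J - I) \<in> null F"
    proof (rule formal_sum_null_scale[symmetric, where c = "neg_one F"])
      fix j assume j: "j \<in> J - I"
      have P: "lead (u j) (P (insert j I)) \<in> carrier0 F" "lead (c - u j) (P (J - {j})) \<in> carrier0 F"
        using PiE_mem[OF Pc] B[of j] B'[OF j] j by auto
      show "mult0 F (lead_circ F u c P J j) (cocirc F (initial E r P u) I j) \<in> carrier0 F"
        using j P by (simp add: lead_circ_def cocirc_def init)
      have "lead c (f j) = mult0 F (sign0 F (plucker_sign j I J))
          (mult0 F (lead (u j) (P (insert j I))) (lead (c - u j) (P (J - {j}))))"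
        using lead_mult0[OF ge[OF j] lb, of j F] j by (simp add: f_def)
      then show "lead c (f j) = mult0 F (Some (neg_one F))
          (mult0 F (lead_circ F u c P J j) (cocirc F (initial E r P u) I j))"
        using plucker_term[OF fin _ j P] I J j by (simp add: lead_circ_def cocirc_def init nsets_def)
    qed (use fin neg_one in auto)
    finally show ?thesis
      by (intro lead_nullD[of "J - I" c f j0]) (use fin le j0' fc in auto)
  qed
  then show "formal_sum (\<lambda>j. mult0 ?T (sign0 ?T (plucker_sign j I J))
      (mult0 ?T (P (insert j I)) (P (J - {j})))) (J - I) \<in> null ?T"
    by (simp add: f_def[abs_def])
qed

theorem theorem1:
  fixes F :: "'a tract"
    and E :: "'e::linorder set"
    and r :: nat
    and P :: "'e set \<Rightarrow> ('a \<times> 'g::linordered_ab_group_add) option"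
  assumes "perfect_tract F"
    and "finite E"
    and "1 \<le> r" and "r \<le> card E"
    and "P \<in> nsets E r \<rightarrow>\<^sub>E carrier0 (tropical_extension F)"
  shows "(\<exists>M \<in> matroids (tropical_extension F) E r. P \<in> M) \<longleftrightarrow>
    (\<forall>u :: 'e \<Rightarrow> 'g. \<exists>M \<in> matroids F E r. initial E r P u \<in> M)"
proof -
  interpret perfect_tract F by (rule assms(1))
  have "(\<exists>M \<in> matroids (tropical_extension F) E r. P \<in> M) \<longleftrightarrow>
      plucker_vector (tropical_extension F) E r P"
    by (rule ex_matroid_iff) (auto simp: one_tropical)
  moreover have "(\<exists>M \<in> matroids F E r. initial E r P u \<in> M) \<longleftrightarrow>
      plucker_vector F E r (initial E r P u)" for u
    by (rule ex_matroid_iff) auto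
  ultimately show ?thesis
    using plucker_vector_initial[OF assms(2)] plucker_vector_of_initial[OF assms(2,5)] by blast
qed

end
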